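(* Every Q-complete set $A$ has hard instances, even with respect to $\overline{ic}$; that is, for every Q-complete set $A$ there is a constant $c$ such that $ic(x:A) \geq C(x) - c$ for infinitely many $x$, and there is a constant $c'$ such that $\overline{ic}(x:A) \geq C(x) - c'$ for infinitely many $x$.
   Context: $\mathbb{N}$ is identified with $\{0,1\}^*$ via the canonical (length-lexicographic) bijection, so sets may be viewed as subsets of either. $\{W_e\}_{e\in\mathbb{N}}$ is the standard enumeration of all r.e. sets and $K = \{e : e \in W_e\}$ is the halting set. A set $A$ is Q-complete if it is r.e. and there is a total recursive function $g$ such that for all $x$: $x \in K \Leftrightarrow W_{g(x)} \subseteq A$. $\lambda$ is the empty string, $l(p)$ is the length of $p \in \{0,1\}^*$, $\chi_A$ is the characteristic function of $A$, and $\perp$ is a special symbol ("don't know"). A (possibly partial) function $f : \{0,1\}^* \to \{0,1,\perp\}$ is $A$-consistent if for all $x \in \mathrm{dom}(f)$, $f(x) = \chi_A(x)$ or $f(x) = \perp$. For a partial recursive mapping $V : \{0,1\}^* \times \{0,1\}^* \to \{0,1\}^* \cup \{\perp\}$, $x \in \{0,1\}^*$ and $A \subseteq \{0,1\}^*$, define - $C_V(x) = \min\{ l(p) : V(p,\lambda) = x\}$ (Kolmogorov complexity); - $ic_V(x:A) = \min\{ l(p) : z \mapsto V(p,z)$ is a total $A$-consistent function and $V(p,x) = \chi_A(x)\}$ (instance complexity); - $\overline{ic}_V(x:A)$: the same as $ic_V(x:A)$ but without requiring that $z \mapsto V(p,z)$ be total; with value $\infty$ if no such $p$ exists. (The output values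 $0,1$ of $V$ are regarded as the one-letter strings $0,1$.) Fix an optimal partial recursive mapping $U : \{0,1\}^* \times \{0,1\}^* \to \{0,1\}^* \cup \{\perp\}$, i.e., one such that for every partial recursive mapping $V : \{0,1\}^* \times \{0,1\}^* \to \{0,1\}^* \cup \{\perp\}$ there is a constant $d$ with $C_U(x) \leq C_V(x) + d$, $ic_U(x:A) \leq ic_V(x:A) + d$ and $\overline{ic}_U(x:A) \leq \overline{ic}_V(x:A) + d$ for all $x, A$. Write $C$, $ic$, $\overline{ic}$ for $C_U$, $ic_U$, $\overline{ic}_U$. *)

theory Defs
  imports Main "HOL-Library.Nat_Bijection" "HOL-Library.Extended_Nat"
begin

text \<open>Partial recursive functions on the naturals, presented by programs for unary functions.
  Several arguments are packed with the Cantor pairing \<^const>\<open>prod_encode\<close>; the class is generated from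
  zero, successor and the two unpairing functions by pairing, composition, primitive recursion and
  unbounded minimization.\<close>

datatype recf =
    RZero
  | RSucc
  | RFst
  | RSnd
  | RPair recf recf
  | RComp recf recf
  | RPrec recf recf
  | RMin recf

text \<open>\<^const>\<open>None\<close> is divergence. Minimization converges to \<open>n\<close> only if the function searched
  converges to a nonzero value at every \<open>m < n\<close>.\<close>

primrec reval :: "recf \<Rightarrow> nat \<Rightarrow> nat option" where
  "reval RZero = (\<lambda>x. Some 0)"
| "reval RSucc = (\<lambda>x. Some (Suc x))"
| "reval RFst = (\<lambda>x. Some (fst (prod_decode x)))"
| "reval RSnd = (\<lambda>x. Some (snd (prod_decode x)))"
| "reval (RPair f g) =
    (\<lambda>x. Option.bind (reval f x) (\<lambda>a. Option.bind (reval g x) (\<lambda>b. Some (prod_encode (a, b)))))"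
| "reval (RComp f g) = (\<lambda>x. Option.bind (reval g x) (reval f))"
| "reval (RPrec f g) =
    (\<lambda>x. case prod_decode x of (a, n) \<Rightarrow>
      rec_nat (reval f a)
        (\<lambda>m r. Option.bind r (\<lambda>i. reval g (prod_encode (a, prod_encode (m, i))))) n)"
| "reval (RMin f) =
    (\<lambda>x. let P = (\<lambda>n. reval f (prod_encode (x, n)) = Some 0 \<and>
                      (\<forall>m<n. \<exists>k. reval f (prod_encode (x, m)) = Some (Suc k)))
         in if \<exists>n. P n then Some (THE n. P n) else None)"

definition partial_recursive :: "(nat \<Rightarrow> nat option) \<Rightarrow> bool" where
  "partial_recursive f \<longleftrightarrow> (\<exists>c. f = reval c)"

definition total_recursive :: "(nat \<Rightarrow> nat) \<Rightarrow> bool" where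
  "total_recursive g \<longleftrightarrow> partial_recursive (\<lambda>x. Some (g x))"

definition recursively_enumerable :: "nat set \<Rightarrow> bool" where
  "recursively_enumerable A \<longleftrightarrow> (\<exists>f. partial_recursive f \<and> A = dom f)"

text \<open>The standard enumeration is given by a Goedel numbering of the programs.\<close>

function recf_of_nat :: "nat \<Rightarrow> recf" where
  "recf_of_nat n =
    (if n = 0 then RZero
     else if n = 1 then RSucc
     else if n = 2 then RFst
     else if n = 3 then RSnd
     else let k = (n - 4) div 4; a = fst (prod_decode k); b = snd (prod_decode k) in
       if (n - 4) mod 4 = 0 then RPair (recf_of_nat a) (recf_of_nat b)
       else if (n - 4) mod 4 = 1 then RComp (recf_of_nat a) (recf_of_nat b)
       else if (n - 4) mod 4 = 2 then RPrec (recf_of_nat a) (recf_of_nat b)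
       else RMin (recf_of_nat k))"
  by pat_completeness auto

lemma fst_prod_decode_le: "fst (prod_decode k) \<le> k"
  by (metis le_prod_encode_1 prod.collapse prod_decode_inverse)

lemma snd_prod_decode_le: "snd (prod_decode k) \<le> k"
  by (metis le_prod_encode_2 prod.collapse prod_decode_inverse)

termination
proof (relation "measure id", goal_cases)
  case 1
  show ?case by simp
qed (use fst_prod_decode_le snd_prod_decode_le in
      \<open>auto intro!: le_less_trans[OF fst_prod_decode_le] le_less_trans[OF snd_prod_decode_le]\<close>)

declare recf_of_nat.simps [simp del]

lemma recf_of_nat_eqs:
  "recf_of_nat 0 = RZero"
  "recf_of_nat 1 = RSucc"
  "recf_of_nat 2 = RFst"
  "recf_of_nat 3 = RSnd"
  "recf_of_nat (4 * prod_encode (a, b) + 4) = RPair (recf_of_nat a) (recf_of_nat b)"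
  "recf_of_nat (4 * prod_encode (a, b) + 5) = RComp (recf_of_nat a) (recf_of_nat b)"
  "recf_of_nat (4 * prod_encode (a, b) + 6) = RPrec (recf_of_nat a) (recf_of_nat b)"
  "recf_of_nat (4 * k + 7) = RMin (recf_of_nat k)"
proof -
  have *: "(4 * j + 4 + r - 4) div 4 = j" "(4 * j + 4 + r - 4) mod 4 = r" if "r < 4" for j r :: nat
    using that by auto
  show "recf_of_nat (4 * prod_encode (a, b) + 4) = RPair (recf_of_nat a) (recf_of_nat b)"
    using *[of 0 "prod_encode (a, b)"] by (subst recf_of_nat.simps) (simp add: Let_def)
  show "recf_of_nat (4 * prod_encode (a, b) + 5) = RComp (recf_of_nat a) (recf_of_nat b)"
    using *[of 1 "prod_encode (a, b)"] by (subst recf_of_nat.simps) (simp add: Let_def)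
  show "recf_of_nat (4 * prod_encode (a, b) + 6) = RPrec (recf_of_nat a) (recf_of_nat b)"
    using *[of 2 "prod_encode (a, b)"] by (subst recf_of_nat.simps) (simp add: Let_def)
  show "recf_of_nat (4 * k + 7) = RMin (recf_of_nat k)"
    using *[of 3 k] by (subst recf_of_nat.simps) (simp add: Let_def)
qed (simp_all add: recf_of_nat.simps)

lemma surj_recf_of_nat: "surj recf_of_nat"
proof -
  have "\<exists>n. recf_of_nat n = c" for c
    by (induction c) (metis recf_of_nat_eqs)+
  then show ?thesis by (metis surjI)
qed

definition W :: "nat \<Rightarrow> nat set" where
  "W e = dom (reval (recf_of_nat e))"

lemma range_W: "range W = {A. recursively_enumerable A}"
proof (intro set_eqI iffI)
  fix A assume "A \<in> {A. recursively_enumerable A}"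
  then obtain c where "A = dom (reval c)"
    by (auto simp: recursively_enumerable_def partial_recursive_def)
  moreover obtain e where "recf_of_nat e = c"
    using surj_recf_of_nat by (metis surjD)
  ultimately show "A \<in> range W" by (auto simp: W_def)
qed (auto simp: W_def recursively_enumerable_def partial_recursive_def)

definition halting_set :: "nat set" where
  "halting_set = {e. e \<in> W e}"

definition Q_complete :: "nat set \<Rightarrow> bool" where
  "Q_complete A \<longleftrightarrow> recursively_enumerable A \<and>
    (\<exists>g. total_recursive g \<and> (\<forall>x. x \<in> halting_set \<longleftrightarrow> W (g x) \<subseteq> A))"

type_synonym str = "bool list"

text \<open>The length-lexicographic bijection: the value of the binary numeral \<open>1s\<close>, minus one.\<close>

definition nat_of_str :: "str \<Rightarrow> nat" where
  "nat_of_str s = foldl (\<lambda>n b. 2 * n + 1 + of_bool b) 0 s"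

lemma bij_nat_of_str: "bij nat_of_str"
proof (rule bijI)
  have step: "nat_of_str (s @ [b]) = 2 * nat_of_str s + 1 + of_bool b" for s b
    by (simp add: nat_of_str_def)
  have nil: "nat_of_str [] = 0" by (simp add: nat_of_str_def)
  show "inj nat_of_str"
  proof (rule injI)
    fix s t show "nat_of_str s = nat_of_str t \<Longrightarrow> s = t"
    proof (induction s arbitrary: t rule: rev_induct)
      case Nil
      then show ?case by (cases t rule: rev_cases) (auto simp: nil step)
    next
      case (snoc b s)
      then obtain t' c where t: "t = t' @ [c]"
        by (cases t rule: rev_cases) (auto simp: nil step)
      have "2 * nat_of_str s + 1 + of_bool b = 2 * nat_of_str t' + 1 + of_bool c"
        using snoc.prems t by (simp add: step)
      then have "nat_of_str s = nat_of_str t' \<and> b = c"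
        by (cases b; cases c) (auto, presburger+)
      then show ?case using snoc.IH t by auto
    qed
  qed
  have "\<exists>s. nat_of_str s = n" for n
  proof (induction n rule: less_induct)
    case (less n)
    show ?case
    proof (cases "n = 0")
      case True
      then show ?thesis using nil by blast
    next
      case False
      then have "(n - 1) div 2 < n" by linarith
      then obtain s where "nat_of_str s = (n - 1) div 2" using less by blast
      then have "nat_of_str (s @ [even n]) = n"
        using False by (auto simp: step elim!: evenE oddE)
      then show ?thesis by blast
    qed
  qed
  then show "surj nat_of_str" by (metis surjI)
qed

datatype answer = Str str | Bot

type_synonym mapping = "str \<Rightarrow> str \<Rightarrow> answer option"

primrec nat_of_answer :: "answer \<Rightarrow> nat" where
  "nat_of_answer Bot = 0"
| "nat_of_answer (Str s) = Suc (nat_of_str s)"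

definition partial_recursive_mapping :: "mapping \<Rightarrow> bool" where
  "partial_recursive_mapping V \<longleftrightarrow>
    (\<exists>f. partial_recursive f \<and>
      (\<forall>p z. map_option nat_of_answer (V p z) = f (prod_encode (nat_of_str p, nat_of_str z))))"

definition chi :: "str set \<Rightarrow> str \<Rightarrow> answer" where
  "chi A x = Str [x \<in> A]"

definition consistent :: "str set \<Rightarrow> (str \<Rightarrow> answer option) \<Rightarrow> bool" where
  "consistent A f \<longleftrightarrow> (\<forall>x \<in> dom f. f x = Some (chi A x) \<or> f x = Some Bot)"

text \<open>The infimum of a nonempty set of extended naturals is attained; that of the empty set is
  \<^term>\<open>\<infinity> :: enat\<close>.\<close>

definition kolmogorov :: "mapping \<Rightarrow> str \<Rightarrow> enat" where
  "kolmogorov V x = Inf {enat (length p) | p. V p [] = Some (Str x)}"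

definition ic :: "mapping \<Rightarrow> str \<Rightarrow> str set \<Rightarrow> enat" where
  "ic V x A = Inf {enat (length p) | p.
     dom (V p) = UNIV \<and> consistent A (V p) \<and> V p x = Some (chi A x)}"

definition ic_bar :: "mapping \<Rightarrow> str \<Rightarrow> str set \<Rightarrow> enat" where
  "ic_bar V x A = Inf {enat (length p) | p.
     consistent A (V p) \<and> V p x = Some (chi A x)}"

definition optimal :: "mapping \<Rightarrow> bool" where
  "optimal U \<longleftrightarrow> partial_recursive_mapping U \<and>
    (\<forall>V. partial_recursive_mapping V \<longrightarrow>
      (\<exists>d::nat. \<forall>x A. kolmogorov U x \<le> kolmogorov V x + enat d \<and>
                     ic U x A \<le> ic V x A + enat d \<and>
                     ic_bar U x A \<le> ic_bar V x A + enat d))"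

end

theory Submission
  imports Defs
begin

text \<open>
  Hard instances are found outside \<open>A\<close>, where deciding \<open>z\<close> means claiming \<open>z \<notin> A\<close>. If \<open>B\<close> is any r.e.
  set, then composing a reduction of \<open>B\<close> to \<open>K\<close> with the Q-reduction gives r.e. sets \<open>E i\<close> with
  \<open>i \<in> B \<longleftrightarrow> E i \<subseteq> A\<close>; by self-reference, \<open>B\<close> may be enumerated with the sets \<open>E i\<close> in view. Putting \<open>i\<close>
  into \<open>B\<close> refutes every program that claims some element of \<open>E i\<close>.

  The indices \<open>i = (m, j)\<close> are arranged in groups \<open>m\<close>. In each group the current index is the first one
  not yet in \<open>B\<close>, and a program \<open>q\<close> is recorded at the current index \<open>i\<close> when it is the least
  unrefuted program claiming an element of \<open>E i\<close>. If \<open>q\<close> gets recorded in two groups, the index in the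
  later group is put into \<open>B\<close>. This is a finite injury argument: group \<open>m\<close> loses an index only
  through a program recorded in an earlier group; the earlier groups settle and then admit only
  boundedly many programs, each of which is refuted once it has cost group \<open>m\<close> an index. So every
  group keeps an index \<open>y \<notin> B\<close>, and the least correct program \<open>q\<close> claiming an element of \<open>E y\<close> is
  recorded at \<open>y\<close> and nowhere else. Hence \<open>q\<close> computes an element \<open>z\<close> of \<open>E y - A\<close>, so that
  \<open>C z \<le> l q + O(1)\<close>, while every consistent program that decides \<open>z\<close> is at least as long as \<open>q\<close>.

  To make sure that some correct program claims an element of \<open>E y\<close>, each string \<open>z\<close> counts as
  an additional program claiming just \<open>z\<close>; this is harmless since \<open>C z \<le> l z + O(1)\<close> anyway.
\<close>

section \<open>Total recursive functions and decidable predicates\<close>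

definition decidable :: "(nat \<Rightarrow> bool) \<Rightarrow> bool" where
  "decidable P \<longleftrightarrow> total_recursive (\<lambda>x. of_bool (P x))"

lemma total_recursive_iff: "total_recursive f \<longleftrightarrow> (\<exists>c. \<forall>x. reval c x = Some (f x))"
  by (auto simp: total_recursive_def partial_recursive_def fun_eq_iff) metis+

lemma total_recursive_comp:
  assumes "total_recursive f" "total_recursive g"
  shows "total_recursive (\<lambda>x. f (g x))"
proof -
  obtain a b where "\<And>x. reval a x = Some (f x)" "\<And>x. reval b x = Some (g x)"
    using assms unfolding total_recursive_iff by blast
  then have "reval (RComp a b) x = Some (f (g x))" for x by simp
  then show ?thesis unfolding total_recursive_iff by blast
qed

lemma total_recursive_id: "total_recursive (\<lambda>x. x)"
proof -
  have "reval (RPair RFst RSnd) x = Some x" for x by simp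
  then show ?thesis unfolding total_recursive_iff by blast
qed

lemma total_recursive_Suc:
  assumes "total_recursive f" shows "total_recursive (\<lambda>x. Suc (f x))"
proof (rule total_recursive_comp[OF _ assms])
  show "total_recursive Suc" unfolding total_recursive_iff by (metis reval.simps(2))
qed

lemma total_recursive_const: "total_recursive (\<lambda>x. n)"
proof (induction n)
  case 0
  show ?case unfolding total_recursive_iff by (metis reval.simps(1))
qed (rule total_recursive_Suc)

lemma total_recursive_fst:
  assumes "total_recursive f" shows "total_recursive (\<lambda>x. fst (prod_decode (f x)))"
proof (rule total_recursive_comp[OF _ assms])
  show "total_recursive (\<lambda>x. fst (prod_decode x))"
    unfolding total_recursive_iff by (metis reval.simps(3))
qed

lemma total_recursive_snd:
  assumes "total_recursive f" shows "total_recursive (\<lambda>x. snd (prod_decode (f x)))"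
proof (rule total_recursive_comp[OF _ assms])
  show "total_recursive (\<lambda>x. snd (prod_decode x))"
    unfolding total_recursive_iff by (metis reval.simps(4))
qed

lemma total_recursive_pair:
  assumes "total_recursive f" "total_recursive g"
  shows "total_recursive (\<lambda>x. prod_encode (f x, g x))"
proof -
  obtain a b where "\<And>x. reval a x = Some (f x)" "\<And>x. reval b x = Some (g x)"
    using assms unfolding total_recursive_iff by blast
  then have "reval (RPair a b) x = Some (prod_encode (f x, g x))" for x by simp
  then show ?thesis unfolding total_recursive_iff by blast
qed

text \<open>The parameter \<open>x\<close> is threaded through \<open>RPrec\<close>, so the step and
  the number of iterations may both depend on it. The projections in \<open>g\<close> unpack
  parameter, counter and previous value in the order in which \<open>RPrec\<close> packs
  them.\<close>

lemma total_recursive_rec: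
  assumes f: "total_recursive f" and h: "total_recursive h"
    and g: "total_recursive (\<lambda>v. g (fst (prod_decode v)) (fst (prod_decode (snd (prod_decode v))))
      (snd (prod_decode (snd (prod_decode v)))))"
  shows "total_recursive (\<lambda>x. rec_nat (f x) (g x) (h x))"
proof -
  obtain a b where a: "\<And>x. reval a x = Some (f x)"
    and b: "\<And>v. reval b v = Some (g (fst (prod_decode v)) (fst (prod_decode (snd (prod_decode v))))
      (snd (prod_decode (snd (prod_decode v)))))"
    using f g unfolding total_recursive_iff by blast
  have "reval (RPrec a b) (prod_encode (x, n)) = Some (rec_nat (f x) (g x) n)" for x n
    by (induction n) (simp_all add: a b)
  then have *: "reval (RPrec a b) v =
      Some (rec_nat (f (fst (prod_decode v))) (g (fst (prod_decode v))) (snd (prod_decode v)))" for v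
    by (metis prod.collapse prod_decode_inverse)
  have "total_recursive
      (\<lambda>v. rec_nat (f (fst (prod_decode v))) (g (fst (prod_decode v))) (snd (prod_decode v)))"
    unfolding total_recursive_iff using * by blast
  from total_recursive_comp[OF this total_recursive_pair[OF total_recursive_id h]]
  show ?thesis by simp
qed

section \<open>Arithmetic, Boolean operations and bounded quantifiers\<close>

lemma total_recursive_add:
  assumes "total_recursive f" "total_recursive g"
  shows "total_recursive (\<lambda>x. f x + g x)"
proof -
  have "rec_nat a (\<lambda>_ r. Suc r) b = a + b" for a b :: nat by (induction b) auto
  then show ?thesis
    using total_recursive_rec[of f g "\<lambda>_ _ r. Suc r"] assms
      total_recursive_Suc[OF total_recursive_snd[OF total_recursive_snd[OF total_recursive_id]]]
    by simp
qed

lemma total_recursive_mult: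
  assumes "total_recursive f" "total_recursive g"
  shows "total_recursive (\<lambda>x. f x * g x)"
proof -
  have "rec_nat 0 (\<lambda>_ r. r + a) b = a * b" for a b :: nat by (induction b) auto
  then show ?thesis
    using total_recursive_rec[of "\<lambda>_. 0" g "\<lambda>x _ r. r + f x"] assms
    by (simp add: total_recursive_const total_recursive_add total_recursive_snd
        total_recursive_id total_recursive_fst total_recursive_comp[of f])
qed

lemma total_recursive_power:
  assumes "total_recursive f" "total_recursive g"
  shows "total_recursive (\<lambda>x. f x ^ g x)"
proof -
  have "rec_nat 1 (\<lambda>_ r. r * a) b = a ^ b" for a b :: nat by (induction b) auto
  then show ?thesis
    using total_recursive_rec[of "\<lambda>_. 1" g "\<lambda>x _ r. r * f x"] assms
    by (simp add: total_recursive_const total_recursive_mult total_recursive_snd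
        total_recursive_id total_recursive_fst total_recursive_comp[of f])
qed

lemma total_recursive_diff:
  assumes "total_recursive f" "total_recursive g"
  shows "total_recursive (\<lambda>x. f x - g x)"
proof -
  have pred: "total_recursive (\<lambda>x. x - Suc 0)"
  proof -
    have "rec_nat 0 (\<lambda>m _. m) b = b - Suc 0" for b by (induction b) auto
    then show ?thesis
      using total_recursive_rec[of "\<lambda>_. 0" "\<lambda>x. x" "\<lambda>_ m _. m"]
      by (simp add: total_recursive_const total_recursive_snd total_recursive_id total_recursive_fst)
  qed
  have "rec_nat a (\<lambda>_ r. r - Suc 0) b = a - b" for a b :: nat by (induction b) auto
  then show ?thesis
    using total_recursive_rec[of f g "\<lambda>_ _ r. r - Suc 0"] assms
    by (simp add: total_recursive_comp[OF pred] total_recursive_snd total_recursive_id)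
qed

lemma total_recursive_if:
  assumes "decidable P" "total_recursive f" "total_recursive g"
  shows "total_recursive (\<lambda>x. if P x then f x else g x)"
proof -
  have "(if P x then f x else g x) = of_bool (P x) * f x + (1 - of_bool (P x)) * g x" for x
    by simp
  then show ?thesis
    using assms unfolding decidable_def
    by (simp only: total_recursive_add total_recursive_mult total_recursive_diff total_recursive_const)
qed

lemma decidable_comp: "decidable P \<Longrightarrow> total_recursive f \<Longrightarrow> decidable (\<lambda>x. P (f x))"
  unfolding decidable_def by (rule total_recursive_comp)

lemma decidable_eq:
  assumes "total_recursive f" "total_recursive g"
  shows "decidable (\<lambda>x. f x = g x)"
proof -
  have "of_bool (f x = g x) = (1::nat) - ((f x - g x) + (g x - f x))" for x by simp
  then show ?thesis
    using assms unfolding decidable_def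
    by (simp only: total_recursive_add total_recursive_diff total_recursive_const)
qed

lemma decidable_less:
  assumes "total_recursive f" "total_recursive g"
  shows "decidable (\<lambda>x. f x < g x)"
proof -
  have "of_bool (f x < g x) = (1::nat) - (1 - (g x - f x))" for x by simp
  then show ?thesis
    using assms unfolding decidable_def
    by (simp only: total_recursive_diff total_recursive_const)
qed

lemma decidable_not:
  assumes "decidable P" shows "decidable (\<lambda>x. \<not> P x)"
proof -
  have "of_bool (\<not> P x) = (1::nat) - of_bool (P x)" for x by simp
  then show ?thesis
    using assms unfolding decidable_def
    by (simp only: total_recursive_diff total_recursive_const)
qed

lemma decidable_conj:
  assumes "decidable P" "decidable Q" shows "decidable (\<lambda>x. P x \<and> Q x)"
proof -
  have "of_bool (P x \<and> Q x) = (of_bool (P x) * of_bool (Q x) :: nat)" for x by simp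
  then show ?thesis
    using assms unfolding decidable_def by (simp only: total_recursive_mult)
qed

lemma decidable_disj:
  assumes "decidable P" "decidable Q" shows "decidable (\<lambda>x. P x \<or> Q x)"
proof -
  have "decidable (\<lambda>x. \<not> (\<not> P x \<and> \<not> Q x))"
    by (intro decidable_not decidable_conj assms)
  then show ?thesis by simp
qed

lemma decidable_imp:
  assumes "decidable P" "decidable Q" shows "decidable (\<lambda>x. P x \<longrightarrow> Q x)"
  unfolding imp_conv_disj by (intro decidable_disj decidable_not assms)

lemma decidable_bex:
  assumes "decidable (\<lambda>v. P (fst (prod_decode v)) (snd (prod_decode v)))" "total_recursive f"
  shows "decidable (\<lambda>x. \<exists>n<f x. P x n)"
proof -
  have "rec_nat 0 (\<lambda>m r. if P x m then Suc 0 else r) b = of_bool (\<exists>n<b. P x n)" for x b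
    by (induction b) (auto simp: less_Suc_eq)
  moreover have "decidable (\<lambda>v. P (fst (prod_decode v)) (fst (prod_decode (snd (prod_decode v)))))"
    using decidable_comp[OF assms(1), of "\<lambda>v. prod_encode (fst (prod_decode v), fst (prod_decode (snd (prod_decode v))))"]
    by (simp add: total_recursive_pair total_recursive_fst total_recursive_snd total_recursive_id)
  ultimately show ?thesis
    using total_recursive_rec[of "\<lambda>_. 0" f "\<lambda>x m r. if P x m then Suc 0 else r"] assms(2)
    unfolding decidable_def
    by (simp add: total_recursive_const total_recursive_if decidable_def
        total_recursive_snd total_recursive_id)
qed

lemma decidable_ball:
  assumes "decidable (\<lambda>v. P (fst (prod_decode v)) (snd (prod_decode v)))" "total_recursive f"
  shows "decidable (\<lambda>x. \<forall>n<f x. P x n)"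
proof -
  have "decidable (\<lambda>x. \<not> (\<exists>n<f x. \<not> P x n))"
    by (intro decidable_not decidable_bex assms)
  then show ?thesis by simp
qed

text \<open>Finite sets are manipulated through their binary codes. Bit \<open>n\<close> of
  \<open>w\<close> is expressed by bounded quantifiers over quotient and remainder, so division
  itself never has to be shown recursive.\<close>

lemma decidable_set_decode:
  assumes "total_recursive f" "total_recursive g"
  shows "decidable (\<lambda>x. f x \<in> set_decode (g x))"
proof -
  have "n \<in> set_decode w \<longleftrightarrow> (\<exists>a<Suc w. \<exists>b<2 ^ n. w = (2 * a + 1) * 2 ^ n + b)" (is "_ \<longleftrightarrow> ?R") for n w
  proof
    assume "n \<in> set_decode w"
    then have "odd (w div 2 ^ n)" by (simp add: set_decode_def)
    then obtain a where a: "w div 2 ^ n = 2 * a + 1" by (auto elim: oddE)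
    have "w = (2 * a + 1) * 2 ^ n + w mod 2 ^ n" by (metis a div_mult_mod_eq)
    moreover have "a < Suc w"
    proof -
      have "2 * a + 1 \<le> w" using a div_le_dividend[of w "2 ^ n"] by linarith
      then show ?thesis by simp
    qed
    moreover have "w mod 2 ^ n < 2 ^ n" by simp
    ultimately show ?R by blast
  next
    assume ?R
    then obtain a b where "b < 2 ^ n" "w = (2 * a + 1) * 2 ^ n + b" by blast
    then have "w div 2 ^ n = 2 * a + 1" using div_mult_self3[of "2 ^ n" "2 * a + 1" b] by simp
    then show "n \<in> set_decode w" by (simp add: set_decode_def)
  qed
  moreover have "decidable (\<lambda>v. \<exists>a<Suc (snd (prod_decode v)). \<exists>b<2 ^ fst (prod_decode v).
      snd (prod_decode v) = (2 * a + 1) * 2 ^ fst (prod_decode v) + b)"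
    by (intro decidable_bex decidable_eq total_recursive_add total_recursive_mult
        total_recursive_power total_recursive_const total_recursive_Suc total_recursive_fst
        total_recursive_snd total_recursive_id)
  ultimately have "decidable (\<lambda>v. fst (prod_decode v) \<in> set_decode (snd (prod_decode v)))"
    by simp
  from decidable_comp[OF this total_recursive_pair[OF assms]] show ?thesis by simp
qed

lemmas recursive_intros =
  total_recursive_id total_recursive_const total_recursive_Suc total_recursive_fst
  total_recursive_snd total_recursive_pair total_recursive_add total_recursive_mult
  total_recursive_power total_recursive_diff total_recursive_if decidable_eq decidable_less
  decidable_not decidable_conj decidable_disj decidable_imp decidable_bex decidable_ball
  decidable_set_decode

text \<open>Both partial recursive functions of the construction, the enumeration of the discarded
  indices and the decoder, arise as such searches. \<open>RMin\<close> stops at the value 0, so it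
  is applied to the negation of \<open>P\<close>.\<close>

lemma partial_recursive_search:
  assumes "decidable (\<lambda>v. P (fst (prod_decode v)) (snd (prod_decode v)))"
  shows "partial_recursive (\<lambda>x. if \<exists>n. P x n then Some (LEAST n. P x n) else None)"
proof -
  have "total_recursive (\<lambda>v. of_bool (\<not> P (fst (prod_decode v)) (snd (prod_decode v))))"
    using decidable_not[OF assms] unfolding decidable_def .
  then obtain c where c: "\<And>v. reval c v = Some (of_bool (\<not> P (fst (prod_decode v)) (snd (prod_decode v))))"
    unfolding total_recursive_iff by blast
  have 1: "(reval c (prod_encode (x, n)) = Some 0 \<and> (\<forall>m<n. \<exists>k. reval c (prod_encode (x, m)) = Some (Suc k)))
      \<longleftrightarrow> P x n \<and> (\<forall>m<n. \<not> P x m)" for x n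
    by (auto simp: c)
  have 2: "(\<exists>n. P x n \<and> (\<forall>m<n. \<not> P x m)) \<longleftrightarrow> (\<exists>n. P x n)" for x
    using exists_least_iff[of "P x"] by blast
  have 3: "(THE n. P x n \<and> (\<forall>m<n. \<not> P x m)) = (LEAST n. P x n)" if "\<exists>n. P x n" for x
  proof (rule the_equality)
    show "P x (LEAST n. P x n) \<and> (\<forall>m<LEAST n. P x n. \<not> P x m)"
      using LeastI_ex[OF that] not_less_Least by blast
    show "n = (LEAST n. P x n)" if "P x n \<and> (\<forall>m<n. \<not> P x m)" for n
      using that by (metis Least_equality not_le_imp_less)
  qed
  have "reval (RMin c) x = (if \<exists>n. P x n then Some (LEAST n. P x n) else None)" for x
    using 3[of x] by (auto simp: Let_def 1 2)
  then have "reval (RMin c) = (\<lambda>x. if \<exists>n. P x n then Some (LEAST n. P x n) else None)"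
    by (rule ext)
  then show ?thesis unfolding partial_recursive_def by metis
qed

section \<open>Stagewise universal evaluation\<close>

abbreviation pair :: "nat \<Rightarrow> nat \<Rightarrow> nat" where
  "pair x y \<equiv> prod_encode (x, y)"

abbreviation pfst :: "nat \<Rightarrow> nat" where
  "pfst x \<equiv> fst (prod_decode x)"

abbreviation psnd :: "nat \<Rightarrow> nat" where
  "psnd x \<equiv> snd (prod_decode x)"

text \<open>The fact that program \<open>e\<close> maps \<open>x\<close> to \<open>y\<close> is coded by \<^term>\<open>pair e (pair x y)\<close>. A set of facts in which
  each one is justified by others serves as a certificate for all of them: no circularity can arise,
  because a justification only refers to subprograms, or to a smaller recursion argument.\<close>

definition justified :: "nat set \<Rightarrow> nat \<Rightarrow> nat \<Rightarrow> nat \<Rightarrow> bool" where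
  "justified S e x y \<longleftrightarrow>
    e = 0 \<and> y = 0 \<or> e = 1 \<and> y = Suc x \<or> e = 2 \<and> y = pfst x \<or> e = 3 \<and> y = psnd x \<or>
    (\<exists>a b u v. e = 4 * pair a b + 4 \<and> pair a (pair x u) \<in> S \<and> pair b (pair x v) \<in> S \<and> y = pair u v) \<or>
    (\<exists>a b u. e = 4 * pair a b + 5 \<and> pair b (pair x u) \<in> S \<and> pair a (pair u y) \<in> S) \<or>
    (\<exists>a b q. e = 4 * pair a b + 6 \<and> x = pair q 0 \<and> pair a (pair q y) \<in> S) \<or>
    (\<exists>a b q m i. e = 4 * pair a b + 6 \<and> x = pair q (Suc m) \<and>
      pair e (pair (pair q m) i) \<in> S \<and> pair b (pair (pair q (pair m i)) y) \<in> S) \<or>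
    (\<exists>k. e = 4 * k + 7 \<and> pair k (pair (pair x y) 0) \<in> S \<and>
      (\<forall>m<y. \<exists>j. pair k (pair (pair x m) (Suc j)) \<in> S))"

definition closed_set :: "nat set \<Rightarrow> bool" where
  "closed_set S \<longleftrightarrow> (\<forall>n\<in>S. justified S (pfst n) (pfst (psnd n)) (psnd (psnd n)))"

text \<open>\<open>S\<close> occurs only positively in \<open>justified\<close>, so certificates can
  be merged and extended.\<close>

lemma justified_mono:
  assumes "justified S e x y" "S \<subseteq> T"
  shows "justified T e x y"
proof -
  have "justified S e x y \<longrightarrow> justified T e x y"
    unfolding justified_def
    by (intro imp_refl disj_mono conj_mono ex_mono all_mono imp_mono in_mono assms)
  then show ?thesis using assms by blast
qed

lemma closed_set_Un: "closed_set S \<Longrightarrow> closed_set T \<Longrightarrow> closed_set (S \<union> T)"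
  unfolding closed_set_def by (auto intro: justified_mono)

lemma closed_set_UN: "(\<And>m. m \<in> I \<Longrightarrow> closed_set (S m)) \<Longrightarrow> closed_set (\<Union>m\<in>I. S m)"
  unfolding closed_set_def by (fastforce intro: justified_mono)

lemma closed_set_insert:
  "closed_set S \<Longrightarrow> justified S e x y \<Longrightarrow> closed_set (insert (pair e (pair x y)) S)"
  unfolding closed_set_def by (auto intro: justified_mono)

lemma index_cases:
  obtains "e = 0" | "e = 1" | "e = 2" | "e = 3"
  | a b where "e = 4 * pair a b + 4" | a b where "e = 4 * pair a b + 5"
  | a b where "e = 4 * pair a b + 6" | k where "e = 4 * k + 7"
proof -
  consider "e = 0" | "e = 1" | "e = 2" | "e = 3"
    | k where "e = 4 * k + 4" | k where "e = 4 * k + 5" | k where "e = 4 * k + 6"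
    | k where "e = 4 * k + 7"
    by atomize_elim presburger
  moreover have "\<exists>a b. k = pair a b" for k
    by (metis prod.collapse prod_decode_inverse)
  ultimately show thesis using that by cases metis+
qed

text \<open>Subprograms have smaller indices, so induction on \<open>e\<close> reaches every fact
  that a justification relies on, except inside primitive recursion.\<close>

lemma closed_set_sound:
  assumes S: "closed_set S"
  shows "pair e (pair x y) \<in> S \<Longrightarrow> reval (recf_of_nat e) x = Some y"
proof (induction e arbitrary: x y rule: less_induct)
  case (less e)
  have just: "justified S e x' y'" if "pair e (pair x' y') \<in> S" for x' y'
    using S that unfolding closed_set_def by force
  note justE = just[unfolded justified_def]
  have le: "a \<le> pair a b" "b \<le> pair a b" for a b
    by (simp_all add: le_prod_encode_1 le_prod_encode_2)
  show ?case
  proof (cases e rule: index_cases)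
    case (5 a b)
    then have "a < e" "b < e" using le(1)[of a b] le(2)[of b a] by simp_all
    moreover obtain u v where "pair a (pair x u) \<in> S" "pair b (pair x v) \<in> S" "y = pair u v"
      using justE[OF less.prems] 5 by auto presburger+
    ultimately show ?thesis using less.IH 5 by (simp add: recf_of_nat_eqs)
  next
    case (6 a b)
    then have "a < e" "b < e" using le(1)[of a b] le(2)[of b a] by simp_all
    moreover obtain u where "pair b (pair x u) \<in> S" "pair a (pair u y) \<in> S"
      using justE[OF less.prems] 6 by auto presburger+
    ultimately show ?thesis using less.IH 6 by (simp add: recf_of_nat_eqs)
  next
    case (7 a b)
    then have ab: "a < e" "b < e" using le(1)[of a b] le(2)[of b a] by simp_all
    \<comment> \<open>Such a fact may rest on another one about \<open>e\<close> itself, so an inner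
      induction on the recursion argument is needed.\<close>
    have "reval (recf_of_nat e) (pair q n) = Some z" if "pair e (pair (pair q n) z) \<in> S" for q n z
      using that
    proof (induction n arbitrary: z)
      case 0
      then have "pair a (pair q z) \<in> S"
        using justE[OF 0] 7 by auto presburger+
      then show ?case using less.IH ab 7 by (simp add: recf_of_nat_eqs)
    next
      case (Suc n)
      then obtain i where "pair e (pair (pair q n) i) \<in> S" "pair b (pair (pair q (pair n i)) z) \<in> S"
        using justE[OF Suc.prems] 7 by auto presburger+
      then have "reval (recf_of_nat e) (pair q n) = Some i"
        "reval (recf_of_nat b) (pair q (pair n i)) = Some z"
        using Suc.IH less.IH ab by blast+
      then show ?case using 7 by (simp add: recf_of_nat_eqs)
    qed
    then show ?thesis using less.prems by (metis prod.collapse prod_decode_inverse)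
  next
    case (8 k)
    then have k: "k < e" by simp
    have *: "pair k (pair (pair x y) 0) \<in> S" "\<forall>m<y. \<exists>j. pair k (pair (pair x m) (Suc j)) \<in> S"
      using justE[OF less.prems] 8 by auto presburger+
    let ?P = "\<lambda>n. reval (recf_of_nat k) (pair x n) = Some 0 \<and>
      (\<forall>m<n. \<exists>j. reval (recf_of_nat k) (pair x m) = Some (Suc j))"
    have P: "?P y" using * less.IH[OF k] by blast
    moreover have "n = y" if "?P n" for n
      using that P by (metis nat_neq_iff old.nat.distinct(1) option.inject)
    ultimately have "(THE n. ?P n) = y" by (rule the_equality)
    then show ?thesis using P unfolding 8 recf_of_nat_eqs by (auto simp: Let_def)
  next
    case 1
    then have "y = 0" using justE[OF less.prems] by auto
    then show ?thesis unfolding 1 recf_of_nat_eqs by simp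
  next
    case 2
    then have "y = Suc x" using justE[OF less.prems] by auto
    then show ?thesis unfolding 2 recf_of_nat_eqs by simp
  next
    case 3
    then have "y = pfst x" using justE[OF less.prems] by auto
    then show ?thesis unfolding 3 recf_of_nat_eqs by simp
  next
    case 4
    then have "y = psnd x" using justE[OF less.prems] by auto
    then show ?thesis unfolding 4 recf_of_nat_eqs by simp
  qed
qed

text \<open>A convergent computation consults only finitely many values of subprograms; finite
  certificates for these are united and the new fact is added.\<close>

lemma closed_set_complete:
  "reval (recf_of_nat e) x = Some y \<Longrightarrow> \<exists>S. finite S \<and> closed_set S \<and> pair e (pair x y) \<in> S"
proof (induction e arbitrary: x y rule: less_induct)
  case (less e)
  have step: "\<exists>S. finite S \<and> closed_set S \<and> pair e (pair x y) \<in> S"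
    if "finite S" "closed_set S" "justified S e x y" for S x y
    using that closed_set_insert by (metis finite_insert insertI1)
  have le: "a \<le> pair a b" "b \<le> pair a b" for a b
    by (simp_all add: le_prod_encode_1 le_prod_encode_2)
  have base: ?case if "justified {} e x y"
    using step[OF _ _ that] by (simp add: closed_set_def)
  show ?case
  proof (cases e rule: index_cases)
    case (5 a b)
    then have ab: "a < e" "b < e" using le(1)[of a b] le(2)[of b a] by simp_all
    obtain u v where uv: "reval (recf_of_nat a) x = Some u" "reval (recf_of_nat b) x = Some v" "y = pair u v"
      using less.prems 5 by (auto simp: recf_of_nat_eqs bind_eq_Some_conv)
    obtain S T where "finite S" "closed_set S" "pair a (pair x u) \<in> S"
      "finite T" "closed_set T" "pair b (pair x v) \<in> T"
      using less.IH ab uv by meson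
    moreover from this have "justified (S \<union> T) e x y"
      unfolding justified_def using 5 uv by blast
    ultimately show ?thesis using step[of "S \<union> T"] by (simp add: closed_set_Un)
  next
    case (6 a b)
    then have ab: "a < e" "b < e" using le(1)[of a b] le(2)[of b a] by simp_all
    obtain u where u: "reval (recf_of_nat b) x = Some u" "reval (recf_of_nat a) u = Some y"
      using less.prems 6 by (auto simp: recf_of_nat_eqs bind_eq_Some_conv)
    obtain S T where "finite S" "closed_set S" "pair b (pair x u) \<in> S"
      "finite T" "closed_set T" "pair a (pair u y) \<in> T"
      using less.IH ab u by meson
    moreover from this have "justified (S \<union> T) e x y"
      unfolding justified_def using 6 by blast
    ultimately show ?thesis using step[of "S \<union> T"] by (simp add: closed_set_Un)
  next
    case (7 a b)
    then have ab: "a < e" "b < e" using le(1)[of a b] le(2)[of b a] by simp_all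
    have "\<exists>S. finite S \<and> closed_set S \<and> pair e (pair (pair q n) z) \<in> S"
      if "reval (recf_of_nat e) (pair q n) = Some z" for q n z
      using that
    proof (induction n arbitrary: z)
      case 0
      then have "reval (recf_of_nat a) q = Some z" using 7 by (simp add: recf_of_nat_eqs)
      then obtain S where "finite S" "closed_set S" "pair a (pair q z) \<in> S"
        using less.IH ab by meson
      moreover from this have "justified S e (pair q 0) z"
        unfolding justified_def using 7 by blast
      ultimately show ?case using step by blast
    next
      case (Suc n)
      then obtain i where i: "reval (recf_of_nat e) (pair q n) = Some i"
        "reval (recf_of_nat b) (pair q (pair n i)) = Some z"
        using 7 by (auto simp: recf_of_nat_eqs bind_eq_Some_conv)
      obtain S T where "finite S" "closed_set S" "pair e (pair (pair q n) i) \<in> S"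
        "finite T" "closed_set T" "pair b (pair (pair q (pair n i)) z) \<in> T"
        using Suc.IH[OF i(1)] less.IH[OF ab(2) i(2)] by blast
      moreover from this have "justified (S \<union> T) e (pair q (Suc n)) z"
        unfolding justified_def using 7 by blast
      ultimately show ?case using step[of "S \<union> T"] by (simp add: closed_set_Un)
    qed
    then show ?thesis using less.prems by (metis prod.collapse prod_decode_inverse)
  next
    case (8 k)
    then have k: "k < e" by simp
    let ?P = "\<lambda>n. reval (recf_of_nat k) (pair x n) = Some 0 \<and>
      (\<forall>m<n. \<exists>j. reval (recf_of_nat k) (pair x m) = Some (Suc j))"
    have y: "(if \<exists>n. ?P n then Some (THE n. ?P n) else None) = Some y"
      using less.prems unfolding 8 recf_of_nat_eqs by (simp add: Let_def)
    then obtain n where n: "?P n" by (auto split: if_splits)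
    have "n' = n" if "?P n'" for n'
      using that n by (metis nat_neq_iff old.nat.distinct(1) option.inject)
    with n have the: "(THE n. ?P n) = n" by (rule the_equality)
    have ex: "\<exists>n. ?P n" using n by (rule exI)
    have "n = y" using y unfolding if_P[OF ex] the by simp
    have P: "?P y" using n unfolding \<open>n = y\<close> .
    then obtain T where T: "finite T" "closed_set T" "pair k (pair (pair x y) 0) \<in> T"
      using less.IH[OF k] by blast
    \<comment> \<open>Minimization needs the values at all \<open>m < y\<close>, hence one
      certificate for each of them.\<close>
    have "\<forall>m\<in>{..<y}. \<exists>S. finite S \<and> closed_set S \<and> (\<exists>j. pair k (pair (pair x m) (Suc j)) \<in> S)"
      using P less.IH[OF k] by (metis lessThan_iff)
    then obtain S where S: "\<And>m. m < y \<Longrightarrow> finite (S m) \<and> closed_set (S m) \<and>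
        (\<exists>j. pair k (pair (pair x m) (Suc j)) \<in> S m)"
      by (metis lessThan_iff)
    define X where "X = T \<union> (\<Union>m\<in>{..<y}. S m)"
    have "pair k (pair (pair x y) 0) \<in> X" using T by (simp add: X_def)
    moreover have "\<exists>j. pair k (pair (pair x m) (Suc j)) \<in> X" if "m < y" for m
      using S[OF that] that by (auto simp: X_def)
    ultimately have "justified X e x y"
      unfolding justified_def using 8 by blast
    moreover have "closed_set X"
      unfolding X_def using T S by (intro closed_set_Un closed_set_UN) auto
    moreover have "finite X" using T S by (auto simp: X_def)
    ultimately show ?thesis using step by blast
  next
    case 1
    then have "y = 0" using less.prems unfolding 1 recf_of_nat_eqs by simp
    then show ?thesis by (intro base) (simp add: justified_def 1)
  next
    case 2
    then have "y = Suc x" using less.prems unfolding 2 recf_of_nat_eqs by simp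
    then show ?thesis by (intro base) (simp add: justified_def 2)
  next
    case 3
    then have "y = pfst x" using less.prems unfolding 3 recf_of_nat_eqs by simp
    then show ?thesis by (intro base) (simp add: justified_def 3)
  next
    case 4
    then have "y = psnd x" using less.prems unfolding 4 recf_of_nat_eqs by simp
    then show ?thesis by (intro base) (simp add: justified_def 4)
  qed
qed

text \<open>If bit \<open>n\<close> of \<open>w\<close> is set, then \<open>n < 2 ^ n <= w\<close>,
  so a code exceeds every number mentioned in the set that it codes.\<close>

lemma pair_in_set_decode_less:
  assumes "pair a b \<in> set_decode w" shows "a < w" "b < w"
proof -
  have "pair a b < 2 ^ pair a b" by (rule less_exp)
  also have "\<dots> \<le> w"
    using assms by (metis div_greater_zero_iff odd_pos set_decode_def mem_Collect_eq)
  finally have "pair a b < w" .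
  then show "a < w" "b < w" using le_prod_encode_1[of a b] le_prod_encode_2[of b a] by simp_all
qed

lemma less_of_pair_less:
  assumes "pair a b < w" shows "a < w" "b < w"
  using assms le_prod_encode_1[of a b] le_prod_encode_2[of b a] by simp_all

text \<open>The bounds on the witnesses make decidability evident.\<close>

lemma justified_set_decode:
  "justified (set_decode w) e x y \<longleftrightarrow>
    e = 0 \<and> y = 0 \<or> e = 1 \<and> y = Suc x \<or> e = 2 \<and> y = pfst x \<or> e = 3 \<and> y = psnd x \<or>
    (\<exists>a<w. \<exists>b<w. \<exists>u<w. \<exists>v<w. e = 4 * pair a b + 4 \<and> pair a (pair x u) \<in> set_decode w \<and>
      pair b (pair x v) \<in> set_decode w \<and> y = pair u v) \<or>
    (\<exists>a<w. \<exists>b<w. \<exists>u<w. e = 4 * pair a b + 5 \<and> pair b (pair x u) \<in> set_decode w \<and>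
      pair a (pair u y) \<in> set_decode w) \<or>
    (\<exists>a<w. \<exists>b<e. \<exists>q<w. e = 4 * pair a b + 6 \<and> x = pair q 0 \<and> pair a (pair q y) \<in> set_decode w) \<or>
    (\<exists>a<e. \<exists>b<w. \<exists>q<w. \<exists>m<w. \<exists>i<w. e = 4 * pair a b + 6 \<and> x = pair q (Suc m) \<and>
      pair e (pair (pair q m) i) \<in> set_decode w \<and> pair b (pair (pair q (pair m i)) y) \<in> set_decode w) \<or>
    (\<exists>k<w. e = 4 * k + 7 \<and> pair k (pair (pair x y) 0) \<in> set_decode w \<and>
      (\<forall>m<y. \<exists>j<w. pair k (pair (pair x m) (Suc j)) \<in> set_decode w))"
proof -
  have le: "a \<le> pair a b" "b \<le> pair a b" for a b
    by (simp_all add: le_prod_encode_1 le_prod_encode_2)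
  \<comment> \<open>In each of the two clauses for recursion one subprogram occurs in no required
    fact; it is bounded by the index \<open>e\<close> instead.\<close>
  have e: "a < 4 * pair a b + 6" "b < 4 * pair a b + 6" for a b
    using le(1)[of a b] le(2)[of b a] by simp_all
  have f: "a < w \<and> x < w \<and> u < w" if "pair a (pair x u) \<in> set_decode w" for a x u
    using pair_in_set_decode_less[OF that] less_of_pair_less by blast
  have g: "a < w \<and> q < w \<and> m < w \<and> u < w" if "pair a (pair (pair q m) u) \<in> set_decode w" for a q m u
    using f[OF that] less_of_pair_less by blast
  have 5: "(\<exists>a b u v. e = 4 * pair a b + 4 \<and> pair a (pair x u) \<in> set_decode w \<and> pair b (pair x v) \<in> set_decode w \<and> y = pair u v) \<longleftrightarrow>
    (\<exists>a<w. \<exists>b<w. \<exists>u<w. \<exists>v<w. e = 4 * pair a b + 4 \<and> pair a (pair x u) \<in> set_decode w \<and>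
      pair b (pair x v) \<in> set_decode w \<and> y = pair u v)"
    using f by blast
  have 6: "(\<exists>a b u. e = 4 * pair a b + 5 \<and> pair b (pair x u) \<in> set_decode w \<and> pair a (pair u y) \<in> set_decode w) \<longleftrightarrow>
    (\<exists>a<w. \<exists>b<w. \<exists>u<w. e = 4 * pair a b + 5 \<and> pair b (pair x u) \<in> set_decode w \<and>
      pair a (pair u y) \<in> set_decode w)"
    using f by blast
  have 7: "(\<exists>a b q. e = 4 * pair a b + 6 \<and> x = pair q 0 \<and> pair a (pair q y) \<in> set_decode w) \<longleftrightarrow>
    (\<exists>a<w. \<exists>b<e. \<exists>q<w. e = 4 * pair a b + 6 \<and> x = pair q 0 \<and> pair a (pair q y) \<in> set_decode w)"
    using f e by blast
  have 8: "(\<exists>a b q m i. e = 4 * pair a b + 6 \<and> x = pair q (Suc m) \<and>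
      pair e (pair (pair q m) i) \<in> set_decode w \<and> pair b (pair (pair q (pair m i)) y) \<in> set_decode w) \<longleftrightarrow>
    (\<exists>a<e. \<exists>b<w. \<exists>q<w. \<exists>m<w. \<exists>i<w. e = 4 * pair a b + 6 \<and> x = pair q (Suc m) \<and>
      pair e (pair (pair q m) i) \<in> set_decode w \<and> pair b (pair (pair q (pair m i)) y) \<in> set_decode w)"
    (is "?L \<longleftrightarrow> ?R")
  proof
    assume ?L
    then obtain a b q m i where *: "e = 4 * pair a b + 6" "x = pair q (Suc m)"
      "pair e (pair (pair q m) i) \<in> set_decode w" "pair b (pair (pair q (pair m i)) y) \<in> set_decode w"
      by blast
    moreover have "a < e" "b < w" "q < w" "m < w" "i < w"
      using e[of a b] f[OF *(4)] g[OF *(3)] *(1) by simp_all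
    ultimately show ?R by blast
  qed blast
  have j: "(\<exists>j. pair k (pair z (Suc j)) \<in> set_decode w) \<longleftrightarrow>
      (\<exists>j<w. pair k (pair z (Suc j)) \<in> set_decode w)" for k z
    using f by (meson Suc_lessD)
  have 9: "(\<exists>k. e = 4 * k + 7 \<and> pair k (pair (pair x y) 0) \<in> set_decode w \<and>
      (\<forall>m<y. \<exists>j. pair k (pair (pair x m) (Suc j)) \<in> set_decode w)) \<longleftrightarrow>
    (\<exists>k<w. e = 4 * k + 7 \<and> pair k (pair (pair x y) 0) \<in> set_decode w \<and>
      (\<forall>m<y. \<exists>j<w. pair k (pair (pair x m) (Suc j)) \<in> set_decode w))"
    unfolding j using f by blast
  show ?thesis unfolding justified_def 5 6 7 8 9 ..
qed

text \<open>Time is measured by the codes of certificates instead of computation steps, which makes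
  the relation decidable and monotone in \<open>s\<close>.\<close>

definition evaluates_within :: "nat \<Rightarrow> nat \<Rightarrow> nat \<Rightarrow> nat \<Rightarrow> bool" where
  "evaluates_within s e x y \<longleftrightarrow>
    (\<exists>w<s. closed_set (set_decode w) \<and> pair e (pair x y) \<in> set_decode w)"

lemma evaluates_within_mono:
  "evaluates_within s e x y \<Longrightarrow> s \<le> t \<Longrightarrow> evaluates_within t e x y"
  unfolding evaluates_within_def by (meson order_less_le_trans)

lemma ex_evaluates_within:
  "(\<exists>s. evaluates_within s e x y) \<longleftrightarrow> reval (recf_of_nat e) x = Some y"
proof
  assume "reval (recf_of_nat e) x = Some y"
  then obtain S where "finite S" "closed_set S" "pair e (pair x y) \<in> S"
    using closed_set_complete by blast
  then have "evaluates_within (Suc (set_encode S)) e x y"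
    unfolding evaluates_within_def by (intro exI[of _ "set_encode S"]) simp
  then show "\<exists>s. evaluates_within s e x y" ..
qed (auto simp: evaluates_within_def intro: closed_set_sound)

lemma decidable_justified:
  assumes "total_recursive w" "total_recursive e" "total_recursive x" "total_recursive y"
  shows "decidable (\<lambda>v. justified (set_decode (w v)) (e v) (x v) (y v))"
proof -
  have "decidable (\<lambda>v. justified (set_decode (pfst v)) (pfst (psnd v)) (pfst (psnd (psnd v))) (psnd (psnd (psnd v))))"
    unfolding justified_set_decode by (intro recursive_intros)
  from decidable_comp[OF this, of "\<lambda>v. pair (w v) (pair (e v) (pair (x v) (y v)))"] assms
  show ?thesis by (simp add: total_recursive_pair)
qed

lemma decidable_closed_set:
  assumes "total_recursive w"
  shows "decidable (\<lambda>v. closed_set (set_decode (w v)))"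
proof -
  have "closed_set (set_decode w) \<longleftrightarrow> (\<forall>n<w. n \<in> set_decode w \<longrightarrow>
      justified (set_decode w) (pfst n) (pfst (psnd n)) (psnd (psnd n)))" for w
    unfolding closed_set_def
    by (metis less_exp order_less_le_trans div_greater_zero_iff odd_pos set_decode_def mem_Collect_eq)
  moreover have "decidable (\<lambda>w. \<forall>n<w. n \<in> set_decode w \<longrightarrow>
      justified (set_decode w) (pfst n) (pfst (psnd n)) (psnd (psnd n)))"
    by (intro recursive_intros decidable_justified)
  ultimately have "decidable (\<lambda>w. closed_set (set_decode w))" by simp
  from decidable_comp[OF this assms] show ?thesis .
qed

lemma decidable_evaluates_within:
  assumes "total_recursive s" "total_recursive e" "total_recursive x" "total_recursive y"
  shows "decidable (\<lambda>v. evaluates_within (s v) (e v) (x v) (y v))"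
proof -
  have "decidable (\<lambda>v. evaluates_within (pfst v) (pfst (psnd v)) (pfst (psnd (psnd v))) (psnd (psnd (psnd v))))"
    unfolding evaluates_within_def by (intro recursive_intros decidable_closed_set)
  from decidable_comp[OF this, of "\<lambda>v. pair (s v) (pair (e v) (pair (x v) (y v)))"] assms
  show ?thesis by (simp add: total_recursive_pair)
qed

section \<open>Stagewise enumeration of the sets \<open>W e\<close>\<close>

definition enumerated_within :: "nat \<Rightarrow> nat \<Rightarrow> nat \<Rightarrow> bool" where
  "enumerated_within s e x \<longleftrightarrow> (\<exists>y<s. evaluates_within s e x y)"

lemma enumerated_within_mono:
  "enumerated_within s e x \<Longrightarrow> s \<le> t \<Longrightarrow> enumerated_within t e x"
  unfolding enumerated_within_def by (meson evaluates_within_mono order_less_le_trans)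

lemma ex_enumerated_within: "(\<exists>s. enumerated_within s e x) \<longleftrightarrow> x \<in> W e"
proof
  assume "x \<in> W e"
  then obtain y where "reval (recf_of_nat e) x = Some y" by (auto simp: W_def)
  then obtain s where s: "evaluates_within s e x y" by (metis ex_evaluates_within)
  have "enumerated_within (max s (Suc y)) e x"
    unfolding enumerated_within_def
    by (intro exI[of _ y] conjI evaluates_within_mono[OF s]) auto
  then show "\<exists>s. enumerated_within s e x" ..
next
  assume "\<exists>s. enumerated_within s e x"
  then show "x \<in> W e"
    unfolding enumerated_within_def W_def by (metis ex_evaluates_within domI)
qed

lemma decidable_enumerated_within:
  assumes "total_recursive s" "total_recursive e" "total_recursive x"
  shows "decidable (\<lambda>v. enumerated_within (s v) (e v) (x v))"
proof -
  have "decidable (\<lambda>v. enumerated_within (pfst v) (pfst (psnd v)) (psnd (psnd v)))"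
    unfolding enumerated_within_def by (intro recursive_intros decidable_evaluates_within)
  from decidable_comp[OF this, of "\<lambda>v. pair (s v) (pair (e v) (x v))"] assms
  show ?thesis by (simp add: total_recursive_pair)
qed

text \<open>Index 1 is the successor and \<open>4 * pair a b + 5\<close> is composition, so this is
  the \<open>n\<close>-fold composition of \<open>RSucc\<close> with \<open>RZero\<close>. Being
  defined by recursion, the map from \<open>n\<close> to the index is itself total
  recursive.\<close>

definition const_index :: "nat \<Rightarrow> nat" where
  "const_index n = rec_nat 0 (\<lambda>_ r. 4 * pair 1 r + 5) n"

lemma reval_const_index: "reval (recf_of_nat (const_index n)) x = Some n"
proof (induction n)
  case (Suc n)
  have "const_index (Suc n) = 4 * pair 1 (const_index n) + 5" by (simp add: const_index_def)
  then show ?case using Suc by (simp only: recf_of_nat_eqs) simp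
qed (simp add: const_index_def recf_of_nat_eqs)

text \<open>Feeding \<open>u\<close> its own index replaces the recursion theorem in the construction below.\<close>

definition section_index :: "nat \<Rightarrow> nat \<Rightarrow> nat" where
  "section_index u i = 4 * pair u (const_index (pair u i)) + 5"

lemma reval_section_index: "reval (recf_of_nat (section_index u i)) x = reval (recf_of_nat u) (pair u i)"
  unfolding section_index_def recf_of_nat_eqs by (simp add: reval_const_index)

lemma total_recursive_section_index:
  assumes "total_recursive u" "total_recursive i"
  shows "total_recursive (\<lambda>v. section_index (u v) (i v))"
  unfolding section_index_def const_index_def by (intro recursive_intros total_recursive_rec assms)

text \<open>The program \<open>section_index u i\<close> ignores its input, so halting on its own
  index amounts to halting of \<open>u\<close> on \<open>pair u i\<close>.\<close>

lemma section_index_in_halting_set: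
  "section_index u i \<in> halting_set \<longleftrightarrow> reval (recf_of_nat u) (pair u i) \<noteq> None"
  by (auto simp: halting_set_def W_def reval_section_index dom_def)

section \<open>The finite injury construction\<close>

text \<open>An index \<^term>\<open>pair m j\<close> is the \<open>j\<close>-th one of group \<open>m\<close>, and a record \<^term>\<open>pair q i\<close> says that \<open>q\<close> has been the
  least claimant of index \<open>i\<close>. The discarded indices form the set \<open>B\<close>.\<close>

definition discarded :: "nat set \<Rightarrow> nat \<Rightarrow> bool" where
  "discarded R i \<longleftrightarrow> (\<exists>q k. pair q k \<in> R \<and> pair q i \<in> R \<and> pfst k < pfst i)"

definition current :: "nat set \<Rightarrow> nat \<Rightarrow> bool" where
  "current R i \<longleftrightarrow> \<not> discarded R i \<and> (\<forall>j<psnd i. discarded R (pair (pfst i) j))"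

lemma discarded_mono: "discarded R i \<Longrightarrow> R \<subseteq> S \<Longrightarrow> discarded S i"
  unfolding discarded_def by blast

text \<open>The injury argument is kept apart from computability. By stage \<open>s\<close>,
  \<open>claims\<close> reports that program \<open>q\<close> puts \<open>z\<close> outside A,
  \<open>enum\<close> that \<open>z\<close> has appeared in \<open>E i\<close>, and
  \<open>inA\<close> that \<open>z\<close> has appeared in A.\<close>

locale stagewise =
  fixes claims enum :: "nat \<Rightarrow> nat \<Rightarrow> nat \<Rightarrow> bool" and inA :: "nat \<Rightarrow> nat \<Rightarrow> bool"
  assumes claims_mono: "claims s q z \<Longrightarrow> s \<le> t \<Longrightarrow> claims t q z"
    and enum_mono: "enum s i z \<Longrightarrow> s \<le> t \<Longrightarrow> enum t i z"
    and inA_mono: "inA s z \<Longrightarrow> s \<le> t \<Longrightarrow> inA t z"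
begin

text \<open>The bound \<open>z < s\<close> keeps the predicate decidable; a refutation by a larger
  \<open>z\<close> is noticed at a later stage.\<close>

definition alive :: "nat \<Rightarrow> nat \<Rightarrow> bool" where
  "alive s q \<longleftrightarrow> (\<forall>z<s. \<not> (claims s q z \<and> inA s z))"

definition touches :: "nat \<Rightarrow> nat \<Rightarrow> nat \<Rightarrow> bool" where
  "touches s q i \<longleftrightarrow> (\<exists>z<s. claims s q z \<and> enum s i z)"

definition least_claimant :: "nat \<Rightarrow> nat \<Rightarrow> nat \<Rightarrow> bool" where
  "least_claimant s q i \<longleftrightarrow>
    alive s q \<and> touches s q i \<and> (\<forall>r<q. \<not> (alive s r \<and> touches s r i))"

text \<open>Stage \<open>s\<close> treats the single pair \<^term>\<open>psnd s\<close>, so every pair is treated at arbitrarily late stages.\<close>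

primrec records :: "nat \<Rightarrow> nat set" where
  "records 0 = {}"
| "records (Suc s) =
    (if current (records s) (psnd (psnd s)) \<and> least_claimant s (pfst (psnd s)) (psnd (psnd s))
     then insert (psnd s) (records s) else records s)"

abbreviation all_records :: "nat set" where
  "all_records \<equiv> \<Union>s. records s"

abbreviation correct :: "nat \<Rightarrow> bool" where
  "correct q \<equiv> \<forall>s. alive s q"

lemma alive_antimono: "alive t q \<Longrightarrow> s \<le> t \<Longrightarrow> alive s q"
  unfolding alive_def by (meson claims_mono inA_mono order_less_le_trans)

lemma touches_mono: "touches s q i \<Longrightarrow> s \<le> t \<Longrightarrow> touches t q i"
  unfolding touches_def by (meson claims_mono enum_mono order_less_le_trans)

lemma not_correct:
  assumes "claims s q z" "inA t z" shows "\<not> correct q"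
proof -
  let ?u = "max (max s t) (Suc z)"
  have "claims ?u q z" "inA ?u z"
    by (rule claims_mono[OF assms(1)], simp) (rule inA_mono[OF assms(2)], simp)
  then have "\<not> alive ?u q" unfolding alive_def by (auto intro!: exI[of _ z])
  then show ?thesis by blast
qed

lemma records_mono: "s \<le> t \<Longrightarrow> records s \<subseteq> records t"
  by (rule lift_Suc_mono_le[of records]) auto

lemma finite_records: "finite (records s)"
  by (induction s) auto

lemma recordsD:
  "pair q i \<in> records s \<Longrightarrow>
    \<exists>t<s. pair q i \<in> records (Suc t) \<and> current (records t) i \<and> least_claimant t q i"
proof (induction s)
  case (Suc s)
  show ?case
  proof (cases "pair q i \<in> records s")
    case True
    then show ?thesis using Suc.IH less_Suc_eq by blast
  next
    case False
    then have "psnd s = pair q i" using Suc.prems by (auto split: if_splits)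
    moreover from this have "current (records s) i" "least_claimant s q i"
      using Suc.prems False by (auto split: if_splits)
    then show ?thesis using Suc.prems by blast
  qed
qed simp

lemma discarded_all_records:
  "discarded all_records i \<longleftrightarrow> (\<exists>s. discarded (records s) i)"
proof
  assume "discarded all_records i"
  then obtain q k s t where "pair q k \<in> records s" "pair q i \<in> records t" "pfst k < pfst i"
    unfolding discarded_def by blast
  then have "discarded (records (max s t)) i"
    unfolding discarded_def using records_mono[of s "max s t"] records_mono[of t "max s t"]
    by (meson max.cobounded1 max.cobounded2 subsetD)
  then show "\<exists>s. discarded (records s) i" ..
qed (auto intro: discarded_mono)

text \<open>Discarding is permanent and only finitely many indices are concerned, so one stage
  serves for all of them.\<close>

lemma eventually_lower_discarded:
  assumes "\<And>j. j < J \<Longrightarrow> discarded all_records (pair m j)"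
  shows "\<exists>s. \<forall>t\<ge>s. \<forall>j<J. discarded (records t) (pair m j)"
  using assms
proof (induction J)
  case (Suc J)
  then obtain s where s: "\<forall>t\<ge>s. \<forall>j<J. discarded (records t) (pair m j)" by auto
  obtain s' where "discarded (records s') (pair m J)"
    using Suc.prems[of J] discarded_all_records by blast
  then have "\<forall>t\<ge>s'. discarded (records t) (pair m J)"
    by (meson discarded_mono records_mono)
  then have "\<forall>t\<ge>max s s'. \<forall>j<Suc J. discarded (records t) (pair m j)"
    using s by (simp add: less_Suc_eq)
  then show ?case by (intro exI[of _ "max s s'"])
qed simp

text \<open>A refuted program is never again a least claimant, so all its records date from before
  its refutation.\<close>

lemma finite_records_of_incorrect:
  assumes "\<not> correct q" shows "finite {i. pair q i \<in> all_records}"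
proof -
  obtain s where s: "\<not> alive s q" using assms by blast
  have "pair q i \<in> records s" if i: "pair q i \<in> all_records" for i
  proof -
    obtain t where t: "pair q i \<in> records (Suc t)" "least_claimant t q i"
      using i recordsD by blast
    then have "t < s"
      using s alive_antimono unfolding least_claimant_def by (meson not_le_imp_less)
    then show ?thesis using t records_mono[of "Suc t" s] by auto
  qed
  then have "(\<lambda>i. pair q i) ` {i. pair q i \<in> all_records} \<subseteq> records s" by blast
  then have "finite ((\<lambda>i. pair q i) ` {i. pair q i \<in> all_records})"
    using finite_records finite_subset by blast
  then show ?thesis by (rule finite_imageD) (simp add: inj_on_def)
qed

end

text \<open>The first two assumptions say that \<open>E i\<close> lies in A exactly when
  \<open>i\<close> is discarded. Since the records depend on \<open>enum\<close>, this is a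
  fixed-point condition on \<open>enum\<close>. The number \<open>2 * z + 2\<close> is the trivial
  program for \<open>z\<close>.\<close>

locale requirements = stagewise +
  assumes discarded_imp: "discarded all_records i \<Longrightarrow> enum s i z \<Longrightarrow> \<exists>t. inA t z"
    and not_discarded_imp:
      "\<not> discarded all_records i \<Longrightarrow> \<exists>z. (\<exists>s. enum s i z) \<and> \<not> (\<exists>s. inA s z)"
    and trivial_claim: "\<exists>s. claims s (2 * z + 2) z"
    and trivial_claim_only: "claims s (2 * z + 2) z' \<Longrightarrow> z' = z"
begin

lemma discarded_imp_not_correct:
  "discarded all_records i \<Longrightarrow> touches s q i \<Longrightarrow> \<not> correct q"
  unfolding touches_def using discarded_imp not_correct by blast

lemma correct_trivial:
  assumes "\<not> (\<exists>s. inA s z)" shows "correct (2 * z + 2)"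
  using assms trivial_claim_only unfolding alive_def by blast

lemma touches_trivial:
  assumes "enum s i z" shows "\<exists>s. touches s (2 * z + 2) i"
proof -
  obtain t where t: "claims t (2 * z + 2) z" using trivial_claim by blast
  let ?u = "max (max s t) (Suc z)"
  have "claims ?u (2 * z + 2) z" "enum ?u i z"
    by (rule claims_mono[OF t], simp) (rule enum_mono[OF assms], simp)
  then have "touches ?u (2 * z + 2) i"
    unfolding touches_def by (intro exI[of _ z]) auto
  then show ?thesis ..
qed

lemma ex_correct_touches:
  assumes "\<not> discarded all_records i"
  shows "\<exists>q. correct q \<and> (\<exists>s. touches s q i)"
  using not_discarded_imp[OF assms] correct_trivial touches_trivial by blast

text \<open>A correct program claims no element of \<open>E i\<close> for a discarded
  \<open>i\<close>, so neither index is discarded, and by the definition of \<open>discarded\<close>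
  they share a group. Each was current at some stage, when all smaller indices of the group were
  discarded; hence neither precedes the other.\<close>

lemma correct_record_unique:
  assumes q: "correct q" and y: "pair q y \<in> all_records" "\<not> discarded all_records y"
    and i: "pair q i \<in> all_records"
  shows "i = y"
proof -
  obtain t where t: "current (records t) i" "least_claimant t q i"
    using recordsD i by blast
  have i': "\<not> discarded all_records i"
    using t q discarded_imp_not_correct unfolding least_claimant_def by blast
  obtain t' where t': "current (records t') y" using recordsD y by blast
  have group: "pfst i = pfst y"
    using i i' y unfolding discarded_def by (metis nat_neq_iff)
  have "\<not> psnd i < psnd y" 
    using t' i' discarded_all_records group unfolding current_def
    by (metis prod.collapse prod_decode_inverse)
  moreover have "\<not> psnd y < psnd i"
    using t(1) y(2) discarded_all_records group unfolding current_def
    by (metis prod.collapse prod_decode_inverse)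
  ultimately show ?thesis using group
    by (metis nat_neq_iff prod.collapse prod_decode_inverse)
qed

text \<open>Let \<open>J\<close> be the first kept position of the group and \<open>r\<close> a
  correct program touching \<open>pair m J\<close>. From some stage on only \<open>pair m J\<close>
  can be current in the group, and \<open>r\<close> prevents the recording of any program above
  it.\<close>

lemma finite_group_claimants:
  assumes "\<not> discarded all_records (pair m j)"
  shows "finite {q. \<exists>i. pfst i = m \<and> pair q i \<in> all_records}"
proof -
  define J where "J = (LEAST j. \<not> discarded all_records (pair m j))"
  have J: "\<not> discarded all_records (pair m J)"
    unfolding J_def by (rule LeastI[of "\<lambda>j. \<not> discarded all_records (pair m j)", OF assms])
  have "discarded all_records (pair m j)" if "j < J" for j
    using not_less_Least that unfolding J_def by blast
  then obtain s where s: "\<forall>t\<ge>s. \<forall>j<J. discarded (records t) (pair m j)"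
    using eventually_lower_discarded by blast
  obtain r u where r: "correct r" "touches u r (pair m J)"
    using ex_correct_touches[OF J] by blast
  have "q \<in> pfst ` records (max s u) \<or> q \<le> r" if i: "pfst i = m" "pair q i \<in> all_records" for q i
  proof (cases "pair q i \<in> records (max s u)")
    case True
    then show ?thesis by force
  next
    case False
    obtain t where t: "pair q i \<in> records (Suc t)" "current (records t) i" "least_claimant t q i"
      using i recordsD by blast
    have "\<not> Suc t \<le> max s u" using t(1) False records_mono by blast
    then have su: "s \<le> t" "u \<le> t" by simp_all
    have "\<not> psnd i < J"
      using s su t(2) i(1) unfolding current_def by (metis prod.collapse prod_decode_inverse)
    moreover have "\<not> J < psnd i"
      using t(2) J i(1) discarded_all_records unfolding current_def by blast
    ultimately have "i = pair m J" using i(1) by (metis nat_neq_iff prod.collapse prod_decode_inverse)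
    then have "touches t r i" using r touches_mono su by blast
    then have "\<not> r < q" using t(3) r unfolding least_claimant_def by blast
    then show ?thesis by simp
  qed
  then have "{q. \<exists>i. pfst i = m \<and> pair q i \<in> all_records} \<subseteq> pfst ` records (max s u) \<union> {..r}"
    by blast
  then show ?thesis using finite_subset finite_records by blast
qed

text \<open>If a whole group were discarded, each of its indices would carry a record of a program
  from the finite set \<open>Q\<close> of those recorded in earlier groups. But a correct program
  has no record at a discarded index, and an incorrect one has only finitely many records.\<close>

lemma ex_not_discarded: "\<exists>j. \<not> discarded all_records (pair m j)"
proof (induction m rule: less_induct)
  case (less m)
  define Q where "Q = (\<Union>k<m. {q. \<exists>i. pfst i = k \<and> pair q i \<in> all_records})"
  have "finite Q"
    unfolding Q_def using less.IH finite_group_claimants by (intro finite_UN_I) auto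
  show ?case
  proof (rule ccontr)
    assume "\<nexists>j. \<not> discarded all_records (pair m j)"
    then have D: "discarded all_records (pair m j)" for j by blast
    have "finite {j. pair q (pair m j) \<in> all_records}" for q
    proof (cases "correct q")
      case True
      have "pair q (pair m j) \<notin> all_records" for j
      proof
        assume "pair q (pair m j) \<in> all_records"
        then obtain t where "touches t q (pair m j)"
          using recordsD unfolding least_claimant_def by blast
        then show False using discarded_imp_not_correct D True by blast
      qed
      then show ?thesis by simp
    next
      case False
      have "finite (pair m ` {j. pair q (pair m j) \<in> all_records})"
        by (rule finite_subset[OF _ finite_records_of_incorrect[OF False]]) blast
      then show ?thesis by (rule finite_imageD) (simp add: inj_on_def)
    qed
    then have "finite (\<Union>q\<in>Q. {j. pair q (pair m j) \<in> all_records})"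
      using \<open>finite Q\<close> by blast
    moreover have "j \<in> (\<Union>q\<in>Q. {j. pair q (pair m j) \<in> all_records})" for j
      using D[of j] unfolding discarded_def Q_def by auto
    ultimately show False by (metis UNIV_eq_I infinite_UNIV_nat)
  qed
qed

text \<open>Each smaller program that touches \<open>i\<close> is incorrect, hence refuted at some
  stage; as there are finitely many, eventually all of them are gone.\<close>

lemma least_claimant_eventually:
  assumes q: "correct q" "touches s0 q i"
    and least: "\<And>r s. r < q \<Longrightarrow> correct r \<Longrightarrow> \<not> touches s r i"
  shows "\<exists>s. \<forall>t\<ge>s. least_claimant t q i"
proof -
  have "\<exists>s. \<forall>t\<ge>s. \<forall>r<n. \<not> (alive t r \<and> touches t r i)" if "n \<le> q" for n
    using that
  proof (induction n)
    case (Suc n)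
    then obtain s where s: "\<forall>t\<ge>s. \<forall>r<n. \<not> (alive t r \<and> touches t r i)" by auto
    obtain s' where "\<forall>t\<ge>s'. \<not> (alive t n \<and> touches t n i)"
      using least[of n] Suc.prems alive_antimono by (metis Suc_le_lessD)
    then have "\<forall>t\<ge>max s s'. \<forall>r<Suc n. \<not> (alive t r \<and> touches t r i)"
      using s by (simp add: less_Suc_eq)
    then show ?case by (intro exI[of _ "max s s'"])
  qed simp
  then obtain s where "\<forall>t\<ge>s. \<forall>r<q. \<not> (alive t r \<and> touches t r i)" by blast
  then have "\<forall>t\<ge>max s s0. least_claimant t q i"
    unfolding least_claimant_def using q touches_mono by auto
  then show ?thesis by (intro exI[of _ "max s s0"])
qed

lemma ex_final_record:
  "\<exists>q y. pfst y = m \<and> \<not> discarded all_records y \<and> pair q y \<in> all_records \<and> correct q \<and>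
    (\<forall>r s. correct r \<longrightarrow> touches s r y \<longrightarrow> q \<le> r)"
proof -
  define J where "J = (LEAST j. \<not> discarded all_records (pair m j))"
  have J: "\<not> discarded all_records (pair m J)"
    unfolding J_def using ex_not_discarded[of m] by (rule LeastI_ex)
  define y where "y = pair m J"
  have "discarded all_records (pair m j)" if "j < J" for j
    using not_less_Least that unfolding J_def by blast
  then obtain s where s: "\<forall>t\<ge>s. \<forall>j<J. discarded (records t) (pair m j)"
    using eventually_lower_discarded by blast
  then have cur: "current (records t) y" if "t \<ge> s" for t
    unfolding current_def y_def using J discarded_all_records that by auto
  define q where "q = (LEAST q. correct q \<and> (\<exists>s. touches s q y))"
  have q: "correct q \<and> (\<exists>s. touches s q y)"
    unfolding q_def using ex_correct_touches[OF J] unfolding y_def by (rule LeastI_ex)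
  have least: "q \<le> r" if "correct r" "touches s r y" for r s
    unfolding q_def by (rule Least_le) (use that in blast)
  obtain s' where s': "\<forall>t\<ge>s'. least_claimant t q y"
    using least_claimant_eventually[of q _ y] q least by (meson not_le)
  \<comment> \<open>As a pair is at least its first component, this stage is late enough for both
    bounds, and it treats exactly \<open>pair q y\<close>.\<close>
  define t where "t = pair (max s s') (pair q y)"
  have "max s s' \<le> t" unfolding t_def by (rule le_prod_encode_1)
  then have "pair q y \<in> records (Suc t)" using cur s' by (simp add: t_def)
  then have "pair q y \<in> all_records" by blast
  moreover have "pfst y = m" "\<not> discarded all_records y" using J by (simp_all add: y_def)
  ultimately show ?thesis using q least by blast
qed

end

section \<open>Application to Q-complete sets\<close>

lemma partial_recursive_map_option:
  assumes "total_recursive h" "partial_recursive f"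
  shows "partial_recursive (\<lambda>x. map_option h (f x))"
proof -
  obtain a b where "\<And>x. reval a x = Some (h x)" "f = reval b"
    using assms unfolding total_recursive_iff partial_recursive_def by blast
  then have "(\<lambda>x. map_option h (f x)) = reval (RComp a b)"
    by (auto simp: fun_eq_iff split: bind_split)
  then show ?thesis unfolding partial_recursive_def by blast
qed

text \<open>In the application \<open>e\<close> is an index of the optimal mapping,
  \<open>W a\<close> is the Q-complete set and \<open>g\<close> its Q-reduction.\<close>

locale construction =
  fixes e a :: nat and g :: "nat \<Rightarrow> nat"
  assumes g_recursive: "total_recursive g"
    and reduction: "x \<in> halting_set \<longleftrightarrow> W (g x) \<subseteq> W a"
begin

text \<open>As strings, the program \<open>p\<close> becomes \<open>p @ [False]\<close> and the trivial program for \<open>z\<close> becomes \<open>z @ [True]\<close>. The value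
  2 is \<^term>\<open>nat_of_answer (Str [False])\<close>, the answer ``not in \<open>A\<close>''.\<close>

definition claims :: "nat \<Rightarrow> nat \<Rightarrow> nat \<Rightarrow> bool" where
  "claims s q z \<longleftrightarrow>
    (\<exists>p<q. q = 2 * p + 1 \<and> evaluates_within s e (pair p z) 2) \<or> q = 2 * z + 2"

lemma claims_odd: "claims s (2 * p + 1) z \<longleftrightarrow> evaluates_within s e (pair p z) 2"
proof -
  have "2 * p + 1 \<noteq> 2 * z + 2" by presburger
  then show ?thesis by (auto simp: claims_def)
qed

lemma claims_even: "claims s (2 * x + 2) z \<longleftrightarrow> z = x"
proof -
  have "2 * x + 2 \<noteq> 2 * p + 1" for p by presburger
  then show ?thesis by (auto simp: claims_def)
qed

text \<open>Here \<open>E i\<close> is \<open>W (g (section_index u i))\<close>; by the Q-reduction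
  it is contained in \<open>W a\<close> exactly when \<open>u\<close> halts on
  \<open>pair u i\<close>.\<close>

definition enum :: "nat \<Rightarrow> nat \<Rightarrow> nat \<Rightarrow> nat \<Rightarrow> bool" where
  "enum u s i z \<longleftrightarrow> enumerated_within s (g (section_index u i)) z"

definition inA :: "nat \<Rightarrow> nat \<Rightarrow> bool" where
  "inA s z \<longleftrightarrow> enumerated_within s a z"

sublocale stagewise claims "enum u" inA for u
  by standard
    (auto simp: claims_def enum_def inA_def intro: evaluates_within_mono enumerated_within_mono)

section \<open>Decidability of the stages, uniformly in \<open>u\<close>\<close>

lemma decidable_claims:
  assumes "total_recursive s" "total_recursive q" "total_recursive z"
  shows "decidable (\<lambda>v. claims (s v) (q v) (z v))"
proof -
  have "decidable (\<lambda>v. claims (pfst v) (pfst (psnd v)) (psnd (psnd v)))"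
    unfolding claims_def by (intro recursive_intros decidable_evaluates_within)
  from decidable_comp[OF this, of "\<lambda>v. pair (s v) (pair (q v) (z v))"] assms
  show ?thesis by (simp add: total_recursive_pair)
qed

lemma decidable_enum:
  assumes "total_recursive u" "total_recursive s" "total_recursive i" "total_recursive z"
  shows "decidable (\<lambda>v. enum (u v) (s v) (i v) (z v))"
  unfolding enum_def
  by (intro decidable_enumerated_within total_recursive_comp[OF g_recursive]
      total_recursive_section_index assms)

lemma decidable_alive:
  assumes "total_recursive s" "total_recursive q"
  shows "decidable (\<lambda>v. alive (s v) (q v))"
proof -
  have "decidable (\<lambda>v. alive (pfst v) (psnd v))"
    unfolding alive_def inA_def
    by (intro recursive_intros decidable_claims decidable_enumerated_within)
  from decidable_comp[OF this total_recursive_pair[OF assms]] show ?thesis by simp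
qed

lemma decidable_touches:
  assumes "total_recursive u" "total_recursive s" "total_recursive q" "total_recursive i"
  shows "decidable (\<lambda>v. touches (u v) (s v) (q v) (i v))"
proof -
  have "decidable (\<lambda>v. touches (pfst v) (pfst (psnd v)) (pfst (psnd (psnd v))) (psnd (psnd (psnd v))))"
    unfolding touches_def by (intro recursive_intros decidable_claims decidable_enum)
  from decidable_comp[OF this, of "\<lambda>v. pair (u v) (pair (s v) (pair (q v) (i v)))"] assms
  show ?thesis by (simp add: total_recursive_pair)
qed

lemma decidable_least_claimant:
  assumes "total_recursive u" "total_recursive s" "total_recursive q" "total_recursive i"
  shows "decidable (\<lambda>v. least_claimant (u v) (s v) (q v) (i v))"
proof -
  have "decidable (\<lambda>v. least_claimant (pfst v) (pfst (psnd v)) (pfst (psnd (psnd v))) (psnd (psnd (psnd v))))"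
    unfolding least_claimant_def by (intro recursive_intros decidable_alive decidable_touches)
  from decidable_comp[OF this, of "\<lambda>v. pair (u v) (pair (s v) (pair (q v) (i v)))"] assms
  show ?thesis by (simp add: total_recursive_pair)
qed

lemma decidable_discarded:
  assumes "total_recursive w" "total_recursive i"
  shows "decidable (\<lambda>v. discarded (set_decode (w v)) (i v))"
proof -
  have "discarded (set_decode w) i \<longleftrightarrow> (\<exists>q<w. \<exists>k<w. pair q k \<in> set_decode w \<and>
      pair q i \<in> set_decode w \<and> pfst k < pfst i)" for w i
    unfolding discarded_def using pair_in_set_decode_less by blast
  moreover have "decidable (\<lambda>v. \<exists>q<pfst v. \<exists>k<pfst v. pair q k \<in> set_decode (pfst v) \<and>
      pair q (psnd v) \<in> set_decode (pfst v) \<and> pfst k < pfst (psnd v))"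
    by (intro recursive_intros)
  ultimately have "decidable (\<lambda>v. discarded (set_decode (pfst v)) (psnd v))" by simp
  from decidable_comp[OF this total_recursive_pair[OF assms]] show ?thesis by simp
qed

lemma decidable_current:
  assumes "total_recursive w" "total_recursive i"
  shows "decidable (\<lambda>v. current (set_decode (w v)) (i v))"
proof -
  have "decidable (\<lambda>v. current (set_decode (pfst v)) (psnd v))"
    unfolding current_def by (intro recursive_intros decidable_discarded)
  from decidable_comp[OF this total_recursive_pair[OF assms]] show ?thesis by simp
qed

text \<open>A binary code lets the records be computed by primitive recursion. The test for a record
  already present avoids a carry: adding \<open>2 ^ psnd s\<close> is insertion only if that bit is
  clear.\<close>

definition record_code :: "nat \<Rightarrow> nat \<Rightarrow> nat" where
  "record_code u s = rec_nat 0 (\<lambda>s w.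
    if (current (set_decode w) (psnd (psnd s)) \<and>
        least_claimant u s (pfst (psnd s)) (psnd (psnd s))) \<and> psnd s \<notin> set_decode w
    then w + 2 ^ psnd s else w) s"

lemma set_decode_record_code: "set_decode (record_code u s) = records u s"
proof (induction s)
  case (Suc s)
  have "set_decode (w + 2 ^ n) = insert n (set_decode w)" if "n \<notin> set_decode w" for n w
    using that set_decode_plus_power_2[of n w] by (simp add: add.commute)
  then show ?case using Suc by (auto simp: record_code_def)
qed (simp add: record_code_def)

lemma total_recursive_record_code:
  assumes "total_recursive u" "total_recursive s"
  shows "total_recursive (\<lambda>v. record_code (u v) (s v))"
proof -
  have "total_recursive (\<lambda>v. record_code (pfst v) (psnd v))"
    unfolding record_code_def
    by (intro total_recursive_rec recursive_intros decidable_current decidable_least_claimant)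
  from total_recursive_comp[OF this total_recursive_pair[OF assms]] show ?thesis by simp
qed

text \<open>On input \<open>pair v i\<close> the program \<open>c\<close> searches for a stage at
  which the construction with parameter \<open>v\<close> discards \<open>i\<close>. With an index of
  \<open>c\<close> itself as \<open>u\<close>, halting on \<open>pair u i\<close> means being
  discarded in the very construction that uses \<open>u\<close>.\<close>

lemma ex_requirements: "\<exists>u. requirements claims (enum u) inA"
proof -
  have "decidable (\<lambda>v. discarded (set_decode (record_code (pfst (pfst v)) (psnd v))) (psnd (pfst v)))"
    by (intro decidable_discarded total_recursive_record_code recursive_intros)
  from partial_recursive_search[OF this]
  obtain c where "reval c = (\<lambda>x.
      if \<exists>n. discarded (set_decode (record_code (pfst x) n)) (psnd x)
      then Some (LEAST n. discarded (set_decode (record_code (pfst x) n)) (psnd x)) else None)"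
    unfolding partial_recursive_def by metis
  then have c: "reval c x \<noteq> None \<longleftrightarrow> (\<exists>n. discarded (records (pfst x) n) (psnd x))" for x
    by (simp add: set_decode_record_code)
  obtain u where u: "recf_of_nat u = c" using surj_recf_of_nat by (metis surjD)
  have halt: "section_index u i \<in> halting_set \<longleftrightarrow> discarded (\<Union>s. records u s) i" for i
    unfolding section_index_in_halting_set u c discarded_all_records by simp
  have "requirements claims (enum u) inA"
  proof
    show "\<exists>t. inA t z" if "discarded (\<Union>s. records u s) i" "enum u s i z" for i s z
      using that unfolding inA_def enum_def halt[symmetric] reduction ex_enumerated_within
      by (metis ex_enumerated_within subsetD)
    show "\<exists>z. (\<exists>s. enum u s i z) \<and> \<not> (\<exists>s. inA s z)" if "\<not> discarded (\<Union>s. records u s) i" for i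
      using that unfolding inA_def enum_def halt[symmetric] reduction ex_enumerated_within by blast
    show "\<exists>s. claims s (2 * z + 2) z" for z unfolding claims_even by simp
    show "z' = z" if "claims s (2 * z + 2) z'" for s z z'
      using that unfolding claims_even .
  qed
  then show ?thesis ..
qed

text \<open>The decoder \<open>d\<close> recovers the hard instance \<open>z\<close> from
  \<open>q\<close>. \<open>Suc\<close> appears because \<open>nat_of_answer\<close> reserves 0 for
  \<open>Bot\<close>, and \<open>pfst\<close> because the mapping built from \<open>d\<close>
  ignores its second argument; \<open>2 * p + 1\<close> is the number of the string of
  \<open>p\<close> with \<open>False\<close> appended.\<close>

lemma ex_decoder:
  "\<exists>d. partial_recursive (\<lambda>x. map_option Suc (d (pfst x))) \<and>
    (\<forall>b. \<exists>q z. b \<le> z \<and> z \<notin> W a \<and> d q = Some z \<and>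
      (\<forall>p. (\<forall>x. reval (recf_of_nat e) (pair p x) = Some 2 \<longrightarrow> x \<notin> W a) \<longrightarrow>
        reval (recf_of_nat e) (pair p z) = Some 2 \<longrightarrow> q \<le> 2 * p + 1))"
proof -
  obtain u where "requirements claims (enum u) inA" using ex_requirements ..
  then interpret req: requirements claims "enum u" inA .
  \<comment> \<open>\<open>n\<close> packs a stage, an index and an element: by that stage
    \<open>q\<close> is recorded at the index and claims the element, which has appeared in the
    corresponding set.\<close>
  define P where "P q n \<longleftrightarrow> pair q (pfst (psnd n)) \<in> set_decode (record_code u (pfst n)) \<and>
    claims (pfst n) q (psnd (psnd n)) \<and> enum u (pfst n) (pfst (psnd n)) (psnd (psnd n))" for q n
  define d where "d q = map_option (\<lambda>n. psnd (psnd n)) (if \<exists>n. P q n then Some (LEAST n. P q n) else None)" for q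
  have "decidable (\<lambda>v. P (pfst (pfst v)) (psnd v))"
    unfolding P_def
    by (intro recursive_intros decidable_claims decidable_enum total_recursive_record_code)
  from partial_recursive_search[OF this]
  have "partial_recursive (\<lambda>x. map_option (\<lambda>n. Suc (psnd (psnd n)))
      (if \<exists>n. P (pfst x) n then Some (LEAST n. P (pfst x) n) else None))"
    by (intro partial_recursive_map_option recursive_intros)
  then have 1: "partial_recursive (\<lambda>x. map_option Suc (d (pfst x)))"
    by (simp add: d_def option.map_comp comp_def)
  have "\<exists>q. \<forall>m. \<exists>y. pfst y = m \<and> \<not> discarded (\<Union>s. records u s) y \<and>
      pair (q m) y \<in> (\<Union>s. records u s) \<and> (\<forall>s. alive s (q m)) \<and>
      (\<forall>r s. (\<forall>s. alive s r) \<longrightarrow> touches u s r y \<longrightarrow> q m \<le> r)"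
    using req.ex_final_record by (intro choice) blast
  then obtain q y where group: "\<And>m. pfst (y m) = m"
    and kept: "\<And>m. \<not> discarded (\<Union>s. records u s) (y m)"
    and rec: "\<And>m. pair (q m) (y m) \<in> (\<Union>s. records u s)"
    and correct: "\<And>m. \<forall>s. alive s (q m)"
    and least: "\<And>m r s. \<forall>s. alive s r \<Longrightarrow> touches u s r (y m) \<Longrightarrow> q m \<le> r"
    by metis
  \<comment> \<open>The only record of \<open>q m\<close> is at \<open>y m\<close>, which lies in
    group \<open>m\<close>.\<close>
  have "inj q"
    using req.correct_record_unique[OF correct rec kept] rec group by (metis injI)
  have "\<exists>q z. b \<le> z \<and> z \<notin> W a \<and> d q = Some z \<and>
      (\<forall>p. (\<forall>x. reval (recf_of_nat e) (pair p x) = Some 2 \<longrightarrow> x \<notin> W a) \<longrightarrow>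
        reval (recf_of_nat e) (pair p z) = Some 2 \<longrightarrow> q \<le> 2 * p + 1)" for b
  proof -
    have "infinite (range q)" using \<open>inj q\<close> by (simp add: finite_image_iff)
    \<comment> \<open>The trivial program for \<open>z\<close> will give
      \<open>q m <= 2 * z + 2\<close>, so this choice forces \<open>b < z\<close>.\<close>
    then obtain m where m: "2 * b + 2 < q m"
      unfolding infinite_nat_iff_unbounded by blast
    have "\<exists>n. P (q m) n"
    proof -
      obtain s where s: "pair (q m) (y m) \<in> records u s" using rec by blast
      then obtain t where "touches u t (q m) (y m)"
        using recordsD unfolding least_claimant_def by blast
      then obtain z where "claims t (q m) z" "enum u t (y m) z" unfolding touches_def by blast
      then have "claims (max s t) (q m) z" "enum u (max s t) (y m) z"
        using claims_mono enum_mono by (meson max.cobounded2)+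
      moreover have "pair (q m) (y m) \<in> records u (max s t)"
        using s records_mono by (meson max.cobounded1 subsetD)
      ultimately have "P (q m) (pair (max s t) (pair (y m) z))"
        unfolding P_def set_decode_record_code by simp
      then show ?thesis ..
    qed
    define n where "n = (LEAST n. P (q m) n)"
    define z where "z = psnd (psnd n)"
    have "P (q m) n" unfolding n_def using \<open>\<exists>n. P (q m) n\<close> by (rule LeastI_ex)
    then have n: "pair (q m) (pfst (psnd n)) \<in> (\<Union>s. records u s)" "claims (pfst n) (q m) z"
      "enum u (pfst n) (pfst (psnd n)) z"
      unfolding P_def set_decode_record_code z_def by blast+
    \<comment> \<open>The search may stop at any record of \<open>q m\<close>, but there is only
      one, so the element found belongs to \<open>E (y m)\<close>.\<close>
    then have z: "enum u (pfst n) (y m) z"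
      using req.correct_record_unique[OF correct rec kept] by metis
    have dq: "d (q m) = Some z" using \<open>\<exists>n. P (q m) n\<close> by (simp add: d_def z_def n_def)
    have zA: "\<not> (\<exists>s. inA s z)" using not_correct n(2) correct by blast
    then have "z \<notin> W a" unfolding inA_def ex_enumerated_within .
    moreover have "q m \<le> 2 * z + 2"
      using req.touches_trivial[OF z] req.correct_trivial[OF zA] least by blast
    moreover have "q m \<le> 2 * p + 1"
      if p: "\<forall>x. reval (recf_of_nat e) (pair p x) = Some 2 \<longrightarrow> x \<notin> W a"
        "reval (recf_of_nat e) (pair p z) = Some 2" for p
    proof -
      have correct': "\<forall>s. alive s (2 * p + 1)"
      proof (intro allI)
        fix s
        have "\<not> inA s x" if "claims s (2 * p + 1) x" for x
        proof -
          have "evaluates_within s e (pair p x) 2" using that unfolding claims_odd .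
          then have "x \<notin> W a" using p(1) ex_evaluates_within by blast
          then show ?thesis unfolding inA_def using ex_enumerated_within by blast
        qed
        then show "alive s (2 * p + 1)" unfolding alive_def by blast
      qed
      obtain t where t: "evaluates_within t e (pair p z) 2" using p(2) ex_evaluates_within by blast
      let ?u = "max (max (pfst n) t) (Suc z)"
      have "evaluates_within ?u e (pair p z) 2" by (rule evaluates_within_mono[OF t]) simp
      moreover have "enum u ?u (y m) z" by (rule enum_mono[OF z]) simp
      ultimately have "touches u ?u (2 * p + 1) (y m)"
        unfolding touches_def claims_odd by (intro exI[of _ z]) auto
      with correct' show ?thesis by (rule least)
    qed
    ultimately show ?thesis using m dq by (intro exI[of _ "q m"] exI[of _ z]) auto
  qed
  with 1 show ?thesis by blast
qed

end

section \<open>From numbers back to strings\<close>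

lemma length_le_if_nat_of_str_le:
  assumes "nat_of_str s \<le> nat_of_str t" shows "length s \<le> length t"
proof -
  \<comment> \<open>The strings of length \<open>n\<close> occupy the numbers from
    \<open>2 ^ n - 1\<close> to \<open>2 ^ (n + 1) - 2\<close>.\<close>
  have bounds: "2 ^ length s \<le> nat_of_str s + 1 \<and> nat_of_str s + 1 < 2 ^ (length s + 1)" for s
    by (induction s rule: rev_induct) (auto simp: nat_of_str_def)
  have "(2::nat) ^ length s < 2 ^ (length t + 1)"
    using bounds[of s] bounds[of t] assms by linarith
  then have "length s < length t + 1" by (rule power_less_imp_less_exp[rotated]) simp
  then show ?thesis by simp
qed

lemma inj_nat_of_answer: "inj nat_of_answer"
proof (rule injI)
  fix x y assume "nat_of_answer x = nat_of_answer y"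
  then show "x = y"
    using bij_nat_of_str by (cases x; cases y) (auto simp: bij_def inj_eq)
qed

lemma nat_of_answer_eq_2_iff: "nat_of_answer x = 2 \<longleftrightarrow> x = Str [False]"
proof -
  have "nat_of_answer (Str [False]) = 2" by (simp add: nat_of_str_def)
  then show ?thesis using inj_nat_of_answer by (metis injD)
qed

lemma ic_bar_le_ic: "ic_bar U x A \<le> ic U x A"
  unfolding ic_def ic_bar_def by (rule Inf_superset_mono) blast

lemma kolmogorov_le: "V p [] = Some (Str x) \<Longrightarrow> kolmogorov V x \<le> enat (length p)"
  unfolding kolmogorov_def by (rule Inf_lower) blast

theorem theorem4p4:
  fixes U :: mapping and A :: "str set"
  assumes "optimal U" and "Q_complete (nat_of_str ` A)"
  shows "(\<exists>c::nat. infinite {x. ic U x A \<ge> kolmogorov U x - enat c}) \<and>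
         (\<exists>c'::nat. infinite {x. ic_bar U x A \<ge> kolmogorov U x - enat c'})"
proof -
  let ?str = "inv nat_of_str"
  have str [simp]: "?str (nat_of_str s) = s" "nat_of_str (?str n) = n" for s n
    using bij_nat_of_str by (simp_all add: bij_is_inj bij_is_surj surj_f_inv_f)
  have mem: "nat_of_str s \<in> nat_of_str ` A \<longleftrightarrow> s \<in> A" for s
    using bij_nat_of_str by (simp add: bij_is_inj inj_image_mem_iff)
  obtain c where c: "map_option nat_of_answer (U p z) = reval c (pair (nat_of_str p) (nat_of_str z))" for p z
    using assms(1) unfolding optimal_def partial_recursive_mapping_def partial_recursive_def by blast
  obtain e where e: "recf_of_nat e = c" using surj_recf_of_nat by (metis surjD)
  have "nat_of_str ` A \<in> range W"
    using assms(2) unfolding range_W Q_complete_def by simp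
  then obtain a where a: "W a = nat_of_str ` A" by (metis rangeE)
  obtain g where "total_recursive g" "x \<in> halting_set \<longleftrightarrow> W (g x) \<subseteq> W a" for x
    using assms(2) unfolding Q_complete_def a by blast
  then interpret construction e a g by unfold_locales
  obtain d where d: "partial_recursive (\<lambda>x. map_option Suc (d (pfst x)))"
    and hard: "\<And>b. \<exists>q z. b \<le> z \<and> z \<notin> W a \<and> d q = Some z \<and>
      (\<forall>p. (\<forall>x. reval (recf_of_nat e) (pair p x) = Some 2 \<longrightarrow> x \<notin> W a) \<longrightarrow>
        reval (recf_of_nat e) (pair p z) = Some 2 \<longrightarrow> q \<le> 2 * p + 1)"
    using ex_decoder by blast
  have zero: "U p x = Some (Str [False]) \<longleftrightarrow>
      reval (recf_of_nat e) (pair (nat_of_str p) (nat_of_str x)) = Some 2" for p x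
    unfolding e c[symmetric] by (auto simp: map_option_eq_Some nat_of_answer_eq_2_iff)
  \<comment> \<open>The decoder as a mapping: \<open>q\<close>, read as a string, is a description
    of the hard instance.\<close>
  define V :: mapping where "V p x = map_option (\<lambda>z. Str (?str z)) (d (nat_of_str p))" for p x
  have "partial_recursive_mapping V"
    unfolding partial_recursive_mapping_def
    by (rule exI, rule conjI, rule d) (simp add: V_def option.map_comp comp_def)
  then obtain k where k: "kolmogorov U x \<le> kolmogorov V x + enat k" for x
    using assms(1) unfolding optimal_def by blast
  \<comment> \<open>\<open>k\<close> is the cost of passing from \<open>V\<close> to
    \<open>U\<close>, and 1 is the bit that distinguishes programs of \<open>U\<close> from trivial
    ones.\<close>
  have *: "\<exists>x. b \<le> nat_of_str x \<and> kolmogorov U x - enat (k + 1) \<le> ic_bar U x A" for b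
  proof -
    obtain q z where z: "b \<le> z" "z \<notin> W a" "d q = Some z"
      and q: "\<And>p. \<forall>x. reval (recf_of_nat e) (pair p x) = Some 2 \<longrightarrow> x \<notin> W a \<Longrightarrow>
        reval (recf_of_nat e) (pair p z) = Some 2 \<Longrightarrow> q \<le> 2 * p + 1"
      using hard by blast
    define x where "x = ?str z"
    have x: "z = nat_of_str x" by (simp add: x_def)
    have chi: "chi A x = Str [False]" using z(2) mem unfolding a x chi_def by simp
    have "kolmogorov V x \<le> enat (length (?str q))"
      by (rule kolmogorov_le) (simp add: V_def z x_def)
    then have C: "kolmogorov U x \<le> enat (length (?str q)) + enat k"
      using k[of x] by (meson add_right_mono order_trans)
    have "kolmogorov U x - enat (k + 1) \<le> enat (length p)"
      if p: "consistent A (U p)" "U p x = Some (chi A x)" for p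
    proof -
      have "y \<notin> W a" if "reval (recf_of_nat e) (pair (nat_of_str p) y) = Some 2" for y
      proof -
        have "U p (?str y) = Some (Str [False])" using that by (simp add: zero)
        then have "chi A (?str y) = Str [False]"
          using p(1) unfolding consistent_def by force
        then show ?thesis using mem[of "?str y"] by (simp add: a chi_def)
      qed
      moreover have "reval (recf_of_nat e) (pair (nat_of_str p) z) = Some 2"
        using p(2) unfolding chi zero x .
      ultimately have "q \<le> 2 * nat_of_str p + 1" using q by blast
      also have "\<dots> = nat_of_str (p @ [False])" by (simp add: nat_of_str_def)
      finally have "length (?str q) \<le> length p + 1"
        using length_le_if_nat_of_str_le[of "?str q" "p @ [False]"] by simp
      then have "enat (length (?str q)) + enat k \<le> enat (length p + 1 + k)" by simp
      with C have "kolmogorov U x \<le> enat (length p + 1 + k)" by (rule order_trans)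
      \<comment> \<open>The bound makes \<open>kolmogorov U x\<close> finite, so the subtraction is
        that of natural numbers.\<close>
      then show ?thesis by (cases "kolmogorov U x") auto
    qed
    then have "kolmogorov U x - enat (k + 1) \<le> ic_bar U x A"
      unfolding ic_bar_def by (intro Inf_greatest) blast
    then show ?thesis using z(1) x by blast
  qed
  have inf: "infinite {x. kolmogorov U x - enat (k + 1) \<le> ic_bar U x A}" (is "infinite ?S")
  proof
    assume "finite ?S"
    then have "finite (nat_of_str ` ?S)" by (rule finite_imageI)
    then obtain b where b: "\<forall>n \<in> nat_of_str ` ?S. n < b"
      unfolding finite_nat_set_iff_bounded ..
    obtain x where "b \<le> nat_of_str x" "x \<in> ?S" using *[of b] by blast
    with b show False by force
  qed
  moreover have "infinite {x. kolmogorov U x - enat (k + 1) \<le> ic U x A}"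
    by (rule infinite_super[OF _ inf]) (auto intro: order_trans ic_bar_le_ic)
  ultimately show ?thesis by blast
qed

end
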